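(* Let $N\ge 2$ be the number of particles and $T\ge 0$ the final time. For all $x'_{0:T}\in\mathsf X^{T+1}$ and all $D\in\mathcal X^{\otimes(T+1)}$, $$P_{T,N}(x'_{0:T},D)\ \ge\ \epsilon_{T,N}\ \phi_{\mu,0:T}\langle Y_{0:T}\rangle(D),\qquad\text{where}\qquad \epsilon_{T,N}=\prod_{t=0}^{T}\frac{N-1}{2B_{t,T}+N-2},$$ and $$B_{t,T}=\sup_{0\le \ell\le T-t}\frac{|w\langle Y_t\rangle|_\infty\,\big|Q\langle Y_{t+1:t+\ell}\rangle\mathbf 1\big|_\infty}{p_\mu(Y_{t:t+\ell}\mid Y_{0:t-1})},\qquad t\in\{0,\dots,T\}.$$ (A factor with $B_{t,T}=\infty$ is read as $0$.) Here $P_{T,N}$ is the particle Gibbs kernel, $\phi_{\mu,0:T}\langle Y_{0:T}\rangle$ the joint smoothing distribution, and $w$, $Q$, $p_\mu$ are as defined in the context.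
   Context: **State space model.** $(\mathsf X,\mathcal X)$, $(\mathsf Y,\mathcal Y)$ are measurable spaces; $M$ is a Markov kernel on $(\mathsf X,\mathcal X)$; $g:\mathsf X\times\mathsf Y\to[0,\infty)$ is measurable, $g(x,\cdot)$ being the density of a Markov kernel $G(x,\cdot)$ from $\mathsf X$ to $\mathsf Y$ with respect to a nonnegative measure $\kappa$ on $\mathsf Y$; $\mu$ is a probability measure on $\mathsf X$ (initial distribution). The observations $Y_{0:T}=(Y_0,\dots,Y_T)\in\mathsf Y^{T+1}$ are fixed. $p_\mu(y_{0:t})=\int\mu(dx_0)g(x_0,y_0)\prod_{s=1}^tM(x_{s-1},dx_s)g(x_s,y_s)$. For $0\le s\le t$, $p_\mu(y_{s:t}\mid y_{0:s-1})=p_\mu(y_{0:t})/p_\mu(y_{0:s-1})$ (equal to $0$ if $p_\mu(y_{0:s-1})=0$), with $p_\mu(y_{0:t}\mid y_{0:-1})=p_\mu(y_{0:t})$. It is assumed that $0<p_\mu(Y_{0:t})<\infty$ for $0\le t\le T$. $Q\langle y\rangle(x,A)=\int M(x,dx')g(x',y)1_A(x')$, and $Q\langle y_{s:t}\rangle=Q\langle y_s\rangle Q\langle y_{s+1}\rangle\cdots Q\langle y_t\rangle$ (composition of kernels); $\mathbf 1$ is the constant function $1$, and $Q\langle y_{s:t}\rangle\mathbf 1=\mathbf 1$ if $s>t$. $|f|_\infty=\sup|f|$ (pointwise supremum). Joint smoothing distribution: for $D\in\mathcal X^{\otimes(T+1)}$, $\phi_{\mu,0:T}\langle Y_{0:T}\rangle(D)=\frac1{p_\mu(Y_{0:T})}\int\mu(dx_0)g(x_0,Y_0)\prod_{s=1}^TM(x_{s-1},dx_s)g(x_s,Y_s)1_D(x_{0:T})$.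 **Proposals and weights.** For each $y$, $r_0\langle y\rangle$ is a probability measure on $\mathsf X$ with $\mu\ll r_0\langle y\rangle$, and $R\langle y\rangle$ is a Markov kernel on $\mathsf X$ with $Q\langle y\rangle(x,\cdot)\ll R\langle y\rangle(x,\cdot)$ for all $x$. Fix (jointly measurable) versions of the weight functions $w_0\langle y\rangle(x)=g(x,y)\frac{d\mu}{dr_0\langle y\rangle}(x)$ and $w\langle y\rangle(x,x')=\frac{dQ\langle y\rangle(x,\cdot)}{dR\langle y\rangle(x,\cdot)}(x')$. At time $t=0$ the symbol $w\langle Y_0\rangle$ stands for $w_0\langle Y_0\rangle$; so $|w\langle Y_0\rangle|_\infty=\sup_xw_0\langle Y_0\rangle(x)$ and $|w\langle Y_t\rangle|_\infty=\sup_{x,x'}w\langle Y_t\rangle(x,x')$ for $t\ge1$. **Particle Gibbs kernel.** Given a reference trajectory $x'_{0:T}\in\mathsf X^{T+1}$: at time $0$ draw $X_0^1,\dots,X_0^{N-1}$ i.i.d. from $r_0\langle Y_0\rangle$, set $X_0^N=x'_0$, and $\omega_0^i=w_0\langle Y_0\rangle(X_0^i)$ for $1\le i\le N$. For $t=1,\dots,T$: conditionally on the past particles and weights, draw independently for $i=1,\dots,N-1$ an index $A_t^i\in\{1,\dots,N\}$ with $P(A_t^i=j)=\omega_{t-1}^j/\sum_{\ell=1}^N\omega_{t-1}^\ell$ and then $X_t^i\sim R\langle Y_t\rangle(X_{t-1}^{A_t^i},\cdot)$; set $A_t^N=N$, $X_t^N=x'_t$; put $X_{0:t}^i=(X_{0:t-1}^{A_t^i},X_t^i)$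 and $\omega_t^i=w\langle Y_t\rangle(X_{t-1}^{A_t^i},X_t^i)$ for $1\le i\le N$. The weight sums $\sum_i\omega_t^i$ are assumed to be almost surely positive so that the algorithm is well defined. The particle Gibbs kernel is $$P_{T,N}(x'_{0:T},D)=\mathbb E\left[\frac{\sum_{i=1}^N\omega_T^i1_D(X_{0:T}^i)}{\sum_{i=1}^N\omega_T^i}\right],$$ the expectation being over all random variables generated by the algorithm. *)

theory Defs
  imports "HOL-Probability.Probability"
begin

text \<open>
  Measurable spaces are given by measures of which only \<open>space\<close> and \<open>sets\<close> are used; Markov kernels
  are measurable maps into \<open>prob_algebra\<close>.  An observation record \<open>y\<^sub>0, y\<^sub>1, \<dots>\<close> is a function on
  \<open>nat\<close> of which only the values up to the relevant time are used.  Paths \<open>x\<^sub>0\<^sub>:\<^sub>t\<close> are elements of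
  the product space over \<open>{..t}\<close>.
\<close>

abbreviation path_space :: "'a measure \<Rightarrow> nat \<Rightarrow> (nat \<Rightarrow> 'a) measure" where
  "path_space SX t \<equiv> PiM {..t} (\<lambda>_. SX)"

definition init_path :: "'a \<Rightarrow> nat \<Rightarrow> 'a" where
  "init_path x = (\<lambda>_. undefined)(0 := x)"

section \<open>State space model\<close>

text \<open>\<open>path_integral \<mu> M g y t f\<close> is
  \<open>\<integral> \<mu>(dx\<^sub>0) g(x\<^sub>0,y\<^sub>0) \<Prod>\<^sub>s\<^sub>=\<^sub>1\<^sub>.\<^sub>.\<^sub>t M(x\<^sub>s\<^sub>-\<^sub>1,dx\<^sub>s) g(x\<^sub>s,y\<^sub>s) f(x\<^sub>0\<^sub>:\<^sub>t)\<close>, as an iterated integral.\<close>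

primrec path_integral ::
  "'a measure \<Rightarrow> ('a \<Rightarrow> 'a measure) \<Rightarrow> ('a \<Rightarrow> 'b \<Rightarrow> real) \<Rightarrow> (nat \<Rightarrow> 'b) \<Rightarrow> nat
    \<Rightarrow> ((nat \<Rightarrow> 'a) \<Rightarrow> ennreal) \<Rightarrow> ennreal" where
  "path_integral \<mu> M g y 0 f = (\<integral>\<^sup>+ x. ennreal (g x (y 0)) * f (init_path x) \<partial>\<mu>)"
| "path_integral \<mu> M g y (Suc t) f =
     path_integral \<mu> M g y t
       (\<lambda>p. \<integral>\<^sup>+ x. ennreal (g x (y (Suc t))) * f (p(Suc t := x)) \<partial>M (p t))"

definition likelihood ::
  "'a measure \<Rightarrow> ('a \<Rightarrow> 'a measure) \<Rightarrow> ('a \<Rightarrow> 'b \<Rightarrow> real) \<Rightarrow> (nat \<Rightarrow> 'b) \<Rightarrow> nat \<Rightarrow> ennreal" where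
  "likelihood \<mu> M g y t = path_integral \<mu> M g y t (\<lambda>_. 1)"

text \<open>\<open>cond_likelihood \<mu> M g y s t\<close> is \<open>p\<^sub>\<mu>(y\<^sub>s\<^sub>:\<^sub>t | y\<^sub>0\<^sub>:\<^sub>s\<^sub>-\<^sub>1)\<close>.\<close>

definition cond_likelihood ::
  "'a measure \<Rightarrow> ('a \<Rightarrow> 'a measure) \<Rightarrow> ('a \<Rightarrow> 'b \<Rightarrow> real) \<Rightarrow> (nat \<Rightarrow> 'b) \<Rightarrow> nat \<Rightarrow> nat \<Rightarrow> ennreal"
  where
  "cond_likelihood \<mu> M g y s t =
     (if s = 0 then likelihood \<mu> M g y t
      else if likelihood \<mu> M g y (s - 1) = 0 then 0
      else likelihood \<mu> M g y t / likelihood \<mu> M g y (s - 1))"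

definition joint_smoothing ::
  "'a measure \<Rightarrow> ('a \<Rightarrow> 'a measure) \<Rightarrow> ('a \<Rightarrow> 'b \<Rightarrow> real) \<Rightarrow> (nat \<Rightarrow> 'b) \<Rightarrow> nat
    \<Rightarrow> (nat \<Rightarrow> 'a) set \<Rightarrow> ennreal" where
  "joint_smoothing \<mu> M g y T D =
     path_integral \<mu> M g y T (indicator D) / likelihood \<mu> M g y T"

definition Q_kernel ::
  "('a \<Rightarrow> 'a measure) \<Rightarrow> ('a \<Rightarrow> 'b \<Rightarrow> real) \<Rightarrow> 'b \<Rightarrow> 'a \<Rightarrow> 'a measure" where
  "Q_kernel M g y x = density (M x) (\<lambda>x'. ennreal (g x' y))"

text \<open>The kernels \<open>Q\<langle>y\<rangle>\<close> need not be sub-Markovian, so composition is not the monadic bind.\<close>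

definition kernel_comp ::
  "'a measure \<Rightarrow> ('a \<Rightarrow> 'a measure) \<Rightarrow> ('a \<Rightarrow> 'a measure) \<Rightarrow> 'a \<Rightarrow> 'a measure" where
  "kernel_comp SX K L x =
     measure_of (space SX) (sets SX) (\<lambda>A. \<integral>\<^sup>+ x'. emeasure (L x') A \<partial>K x)"

text \<open>\<open>Q\<langle>y\<^sub>s\<^sub>:\<^sub>t\<rangle>\<close>; it is the identity kernel if \<open>s > t\<close>.\<close>

definition Q_comp ::
  "'a measure \<Rightarrow> ('a \<Rightarrow> 'a measure) \<Rightarrow> ('a \<Rightarrow> 'b \<Rightarrow> real) \<Rightarrow> (nat \<Rightarrow> 'b) \<Rightarrow> nat \<Rightarrow> nat
    \<Rightarrow> 'a \<Rightarrow> 'a measure" where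
  "Q_comp SX M g y s t =
     foldr (kernel_comp SX) (map (\<lambda>k. Q_kernel M g (y k)) [s..<Suc t]) (return SX)"

definition kernel_apply :: "('a \<Rightarrow> 'a measure) \<Rightarrow> ('a \<Rightarrow> ennreal) \<Rightarrow> 'a \<Rightarrow> ennreal" where
  "kernel_apply K f x = (\<integral>\<^sup>+ x'. f x' \<partial>K x)"

definition sup_norm :: "'a measure \<Rightarrow> ('a \<Rightarrow> ennreal) \<Rightarrow> ennreal" where
  "sup_norm SX f = (SUP x\<in>space SX. f x)"

section \<open>Particle Gibbs\<close>

text \<open>
  The weight \<open>w\<langle>Y\<^sub>t\<rangle>(X\<^sub>t\<^sub>-\<^sub>1, X\<^sub>t)\<close> of a particle is a function of its path, because the last two states
  on the path \<open>X\<^sub>0\<^sub>:\<^sub>t\<close> of a particle are the state of its ancestor and its own state.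
\<close>

definition weight ::
  "('b \<Rightarrow> 'a \<Rightarrow> real) \<Rightarrow> ('b \<Rightarrow> 'a \<Rightarrow> 'a \<Rightarrow> real) \<Rightarrow> (nat \<Rightarrow> 'b) \<Rightarrow> nat \<Rightarrow> (nat \<Rightarrow> 'a) \<Rightarrow> real" where
  "weight w0 w y t p = (if t = 0 then w0 (y 0) (p 0) else w (y t) (p (t - 1)) (p t))"

definition weight_norm ::
  "'a measure \<Rightarrow> ('b \<Rightarrow> 'a \<Rightarrow> real) \<Rightarrow> ('b \<Rightarrow> 'a \<Rightarrow> 'a \<Rightarrow> real) \<Rightarrow> (nat \<Rightarrow> 'b) \<Rightarrow> nat \<Rightarrow> ennreal" where
  "weight_norm SX w0 w y t =
     (if t = 0 then (SUP x\<in>space SX. ennreal (w0 (y 0) x))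
      else (SUP x\<in>space SX. SUP x'\<in>space SX. ennreal (w (y t) x x')))"

text \<open>Law of an ancestor index in \<open>{1..N}\<close> for given weights.  The value at vanishing total weight is
  an arbitrary convention.\<close>

definition select_index :: "nat \<Rightarrow> (nat \<Rightarrow> real) \<Rightarrow> nat measure" where
  "select_index N \<omega> =
     (if (\<Sum>j=1..N. \<omega> j) = 0 then return (count_space {1..N}) N
      else point_measure {1..N} (\<lambda>i. ennreal (\<omega> i / (\<Sum>j=1..N. \<omega> j))))"

text \<open>
  A particle system at time \<open>t\<close> is the family of paths \<open>(X\<^sub>0\<^sub>:\<^sub>t\<^sup>i)\<close>, \<open>1 \<le> i \<le> N\<close>, and
  \<open>pg_law SX r0 R w0 w N y xref t\<close> is its law for the reference trajectory \<open>xref\<close>.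
\<close>

definition pg_init ::
  "'a measure \<Rightarrow> ('b \<Rightarrow> 'a measure) \<Rightarrow> nat \<Rightarrow> (nat \<Rightarrow> 'b) \<Rightarrow> (nat \<Rightarrow> 'a)
    \<Rightarrow> (nat \<Rightarrow> nat \<Rightarrow> 'a) measure" where
  "pg_init SX r0 N y xref =
     PiM {1..N} (\<lambda>i. if i = N then return (path_space SX 0) (init_path (xref 0))
                     else distr (r0 (y 0)) (path_space SX 0) init_path)"

definition pg_step ::
  "'a measure \<Rightarrow> ('b \<Rightarrow> 'a \<Rightarrow> 'a measure) \<Rightarrow> ('b \<Rightarrow> 'a \<Rightarrow> real) \<Rightarrow> ('b \<Rightarrow> 'a \<Rightarrow> 'a \<Rightarrow> real)
    \<Rightarrow> nat \<Rightarrow> (nat \<Rightarrow> 'b) \<Rightarrow> (nat \<Rightarrow> 'a) \<Rightarrow> nat \<Rightarrow> (nat \<Rightarrow> nat \<Rightarrow> 'a) \<Rightarrow> (nat \<Rightarrow> nat \<Rightarrow> 'a) measure"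
  where
  "pg_step SX R w0 w N y xref t z =
     PiM {1..N} (\<lambda>i.
       if i = N then return (path_space SX (Suc t)) ((z N)(Suc t := xref (Suc t)))
       else select_index N (\<lambda>j. weight w0 w y t (z j)) \<bind>
         (\<lambda>a. distr (R (y (Suc t)) (z a t)) (path_space SX (Suc t)) (\<lambda>x. (z a)(Suc t := x))))"

primrec pg_law ::
  "'a measure \<Rightarrow> ('b \<Rightarrow> 'a measure) \<Rightarrow> ('b \<Rightarrow> 'a \<Rightarrow> 'a measure) \<Rightarrow> ('b \<Rightarrow> 'a \<Rightarrow> real)
    \<Rightarrow> ('b \<Rightarrow> 'a \<Rightarrow> 'a \<Rightarrow> real) \<Rightarrow> nat \<Rightarrow> (nat \<Rightarrow> 'b) \<Rightarrow> (nat \<Rightarrow> 'a) \<Rightarrow> nat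
    \<Rightarrow> (nat \<Rightarrow> nat \<Rightarrow> 'a) measure" where
  "pg_law SX r0 R w0 w N y xref 0 = pg_init SX r0 N y xref"
| "pg_law SX r0 R w0 w N y xref (Suc t) =
     pg_law SX r0 R w0 w N y xref t \<bind> pg_step SX R w0 w N y xref t"

definition particle_gibbs ::
  "'a measure \<Rightarrow> ('b \<Rightarrow> 'a measure) \<Rightarrow> ('b \<Rightarrow> 'a \<Rightarrow> 'a measure) \<Rightarrow> ('b \<Rightarrow> 'a \<Rightarrow> real)
    \<Rightarrow> ('b \<Rightarrow> 'a \<Rightarrow> 'a \<Rightarrow> real) \<Rightarrow> nat \<Rightarrow> (nat \<Rightarrow> 'b) \<Rightarrow> nat \<Rightarrow> (nat \<Rightarrow> 'a)
    \<Rightarrow> (nat \<Rightarrow> 'a) set \<Rightarrow> ennreal" where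
  "particle_gibbs SX r0 R w0 w N y T xref D =
     (\<integral>\<^sup>+ z. ennreal ((\<Sum>i=1..N. weight w0 w y T (z i) * indicator D (z i)) /
                       (\<Sum>i=1..N. weight w0 w y T (z i)))
        \<partial>pg_law SX r0 R w0 w N y xref T)"

definition B_const ::
  "'a measure \<Rightarrow> 'a measure \<Rightarrow> ('a \<Rightarrow> 'a measure) \<Rightarrow> ('a \<Rightarrow> 'b \<Rightarrow> real) \<Rightarrow> ('b \<Rightarrow> 'a \<Rightarrow> real)
    \<Rightarrow> ('b \<Rightarrow> 'a \<Rightarrow> 'a \<Rightarrow> real) \<Rightarrow> (nat \<Rightarrow> 'b) \<Rightarrow> nat \<Rightarrow> nat \<Rightarrow> ennreal" where
  "B_const SX \<mu> M g w0 w y t T =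
     (SUP l\<in>{0..T - t}.
        weight_norm SX w0 w y t *
        sup_norm SX (kernel_apply (Q_comp SX M g y (t + 1) (t + l)) (\<lambda>_. 1)) /
        cond_likelihood \<mu> M g y t (t + l))"

text \<open>In \<open>ennreal\<close>, a factor whose denominator is infinite is \<open>0\<close>.\<close>

definition epsilon_const ::
  "'a measure \<Rightarrow> 'a measure \<Rightarrow> ('a \<Rightarrow> 'a measure) \<Rightarrow> ('a \<Rightarrow> 'b \<Rightarrow> real) \<Rightarrow> ('b \<Rightarrow> 'a \<Rightarrow> real)
    \<Rightarrow> ('b \<Rightarrow> 'a \<Rightarrow> 'a \<Rightarrow> real) \<Rightarrow> (nat \<Rightarrow> 'b) \<Rightarrow> nat \<Rightarrow> nat \<Rightarrow> ennreal" where
  "epsilon_const SX \<mu> M g w0 w y T N =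
     (\<Prod>t=0..T. of_nat (N - 1) / (2 * B_const SX \<mu> M g w0 w y t T + of_nat (N - 2)))"

end

theory Submission
  imports Defs
begin

text \<open>
  For a nonnegative function \<open>f\<close> of paths and \<open>h\<close> of states, consider the expectation of
  \<open>\<Sum>\<^sub>i \<omega>\<^sub>t\<^sup>i f (X\<^sub>0\<^sub>:\<^sub>t\<^sup>i) / \<Sum>\<^sub>i \<omega>\<^sub>t\<^sup>i h (X\<^sub>t\<^sup>i)\<close>.  Given the past, the \<open>N - 1\<close> free particles are
  i.i.d.  In the summand of a free particle \<open>j\<close>, the terms of \<open>j\<close> and of the reference particle in the
  denominator are at most \<open>C = |w\<langle>Y\<^sub>t\<rangle>|\<^sub>\<infinity> |h|\<^sub>\<infinity>\<close> each, and Jensen's inequality for \<open>1/x\<close> applies to the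
  other \<open>N - 2\<close>.  As a weighted proposal integrates like \<open>Q\<langle>Y\<^sub>t\<rangle>\<close>, the result is \<open>N - 1\<close> times a ratio
  of the same kind at time \<open>t - 1\<close>, with \<open>Q\<langle>Y\<^sub>t\<rangle>f\<close> in place of \<open>f\<close> and
  \<open>2 C + (N - 2) Q\<langle>Y\<^sub>t\<rangle>h\<close> in place of \<open>h\<close>.  Starting from \<open>f = 1\<^sub>D\<close> and \<open>h = 1\<close> at time \<open>T\<close>,
  the functions \<open>h\<close> are nonnegative combinations of the \<open>Q\<langle>Y\<^sub>t\<^sub>+\<^sub>1\<^sub>:\<^sub>t\<^sub>+\<^sub>l\<rangle>1\<close>, so each step backwards
  increases the unnormalised filter integral of \<open>h\<close> by a factor of at most \<open>2 B\<^sub>t\<^sub>,\<^sub>T + N - 2\<close>.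
\<close>

section \<open>Ratios of sums of independent variables\<close>

lemma inverse_ennreal_antimono:
  fixes x y :: ennreal
  assumes "x \<le> y"
  shows "inverse y \<le> inverse x"
proof (cases "x = 0 \<or> y = top")
  case False
  then obtain x' y' where "x = ennreal x'" "x' > 0" "y = ennreal y'"
    using assms by (cases x; cases y) (auto simp: less_le top_unique)
  then show ?thesis
    using assms by (auto simp: ennreal_le_iff2 inverse_ennreal le_imp_inverse_le)
qed auto

text \<open>Convexity of 1/s: its graph lies above the tangent at \<open>m\<close>. The linear term
  stands on the right because subtraction in \<open>ennreal\<close> truncates at 0.\<close>

lemma inverse_ennreal_tangent:
  fixes s m :: ennreal
  assumes "m \<noteq> 0" "m \<noteq> top"
  shows "2 * inverse m \<le> inverse s + s * (inverse m * inverse m)"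
proof (cases "s = 0 \<or> s = top")
  case True
  with assms show ?thesis
    by (auto simp: ennreal_top_mult)
next
  case False
  then obtain s' where s: "s = ennreal s'" "s' > 0"
    by (cases s) (auto simp: less_le)
  from assms obtain m' where m: "m = ennreal m'" "m' > 0"
    by (cases m) (auto simp: less_le)
  \<comment> \<open>The gap between 1/s' and its tangent at \<open>m'\<close> is exactly this
    multiple of a square.\<close>
  have "0 \<le> (1 / s') * (1 - s' / m')\<^sup>2"
    using s by simp
  also have "\<dots> = inverse s' + s' * (inverse m' * inverse m') - 2 * inverse m'"
    using s(2) m(2) by (simp add: field_simps power2_eq_square)
  finally have "2 * inverse m' \<le> inverse s' + s' * (inverse m' * inverse m')"
    by simp
  then have "ennreal (2 * inverse m') \<le> ennreal (inverse s' + s' * (inverse m' * inverse m'))"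
    by (rule ennreal_leI)
  then show ?thesis
    using s m by (simp add: inverse_ennreal ennreal_mult ennreal_plus)
qed

text \<open>Jensen's inequality for 1/x, by integrating the tangent at the mean \<open>m\<close>.
  For infinite \<open>m\<close> the left side is 0; for \<open>m = 0\<close> the function vanishes
  almost everywhere and the right side is infinite.\<close>

lemma (in prob_space) inverse_nn_integral_le:
  assumes [measurable]: "f \<in> borel_measurable M"
  shows "inverse (\<integral>\<^sup>+ x. f x \<partial>M) \<le> (\<integral>\<^sup>+ x. inverse (f x) \<partial>M)"
proof -
  define m where "m = (\<integral>\<^sup>+ x. f x \<partial>M)"
  consider "m = top" | "m = 0" | "m \<noteq> 0" "m \<noteq> top"
    by auto
  then have "inverse m \<le> (\<integral>\<^sup>+ x. inverse (f x) \<partial>M)"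
  proof cases
    case 1
    then show ?thesis by simp
  next
    case 2
    then have "AE x in M. f x = 0"
      unfolding m_def by (simp add: nn_integral_0_iff_AE)
    then have "(\<integral>\<^sup>+ x. inverse (f x) \<partial>M) = (\<integral>\<^sup>+ x. top \<partial>M)"
      by (intro nn_integral_cong_AE) auto
    then show ?thesis
      by (simp add: emeasure_space_1)
  next
    case 3
    \<comment> \<open>Allows one copy of \<open>inverse m\<close> to be cancelled at the
      end.\<close>
    have fin: "inverse m \<noteq> top"
      using 3 by simp
    have "inverse m + inverse m = (\<integral>\<^sup>+ x. 2 * inverse m \<partial>M)"
      by (simp add: emeasure_space_1 mult_2)
    also have "\<dots> \<le> (\<integral>\<^sup>+ x. inverse (f x) + f x * (inverse m * inverse m) \<partial>M)"
      by (intro nn_integral_mono inverse_ennreal_tangent 3)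
    also have "\<dots> = (\<integral>\<^sup>+ x. inverse (f x) \<partial>M) + m * (inverse m * inverse m)"
      by (simp add: nn_integral_add nn_integral_multc m_def)
    also have "m * (inverse m * inverse m) = inverse m"
      using 3 ennreal_divide_self[of m] by (simp add: mult.assoc[symmetric] divide_ennreal_def top.not_eq_extremum)
    finally have "inverse m + inverse m \<le> inverse m + (\<integral>\<^sup>+ x. inverse (f x) \<partial>M)"
      by (simp add: add.commute)
    then show ?thesis
      using fin by (simp add: ennreal_add_left_cancel_le)
  qed
  then show ?thesis by (simp add: m_def)
qed

lemma nn_integral_PiM_component:
  assumes "\<And>i. i \<in> I \<Longrightarrow> prob_space (K i)" and i: "i \<in> I" and f: "f \<in> borel_measurable (K i)"
  shows "(\<integral>\<^sup>+ x. f (x i) \<partial>PiM I K) = (\<integral>\<^sup>+ x. f x \<partial>K i)"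
proof -
  have "(\<integral>\<^sup>+ x. f x \<partial>K i) = (\<integral>\<^sup>+ x. f x \<partial>distr (PiM I K) (K i) (\<lambda>x. x i))"
    by (simp add: distr_PiM_component assms)
  also have "\<dots> = (\<integral>\<^sup>+ x. f (x i) \<partial>PiM I K)"
    using i f by (intro nn_integral_distr) auto
  finally show ?thesis by simp
qed

text \<open>
  In the \<open>j\<close>-th summand, the terms \<open>b (z j)\<close> and \<open>b (z k)\<close> of the denominator are bounded by \<open>C\<close>;
  the remaining ones are independent of \<open>z j\<close>, and Jensen's inequality for \<open>1/x\<close> applies to their sum.
\<close>

lemma nn_integral_sum_ratio_ge:
  fixes K :: "'i \<Rightarrow> 'z measure" and a b :: "'z \<Rightarrow> ennreal"
  assumes fin: "finite I" and k: "k \<in> I"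
    and prob: "\<And>i. prob_space (K i)" and sets_K: "\<And>i. sets (K i) = sets S"
    and K: "\<And>i. i \<noteq> k \<Longrightarrow> K i = \<nu>"
    and a[measurable]: "a \<in> borel_measurable S" and b[measurable]: "b \<in> borel_measurable S"
    and bC: "\<And>x. x \<in> space S \<Longrightarrow> b x \<le> C"
  shows "of_nat (card I - 1) * (\<integral>\<^sup>+ x. a x \<partial>\<nu>) / (2 * C + of_nat (card I - 2) * (\<integral>\<^sup>+ x. b x \<partial>\<nu>))
    \<le> (\<integral>\<^sup>+ z. (\<Sum>i\<in>I. a (z i)) / (\<Sum>i\<in>I. b (z i)) \<partial>PiM I K)"
proof -
  interpret product_prob_space K I
    using prob by (simp add: product_prob_space_def product_prob_space_axioms_def
      product_sigma_finite_def prob_space_imp_sigma_finite)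
  note [measurable_cong] = sets_K
  have space_K: "space (K i) = space S" for i
    using sets_K by (rule sets_eq_imp_space_eq)
  have *: "(\<integral>\<^sup>+ x. a x \<partial>\<nu>) * inverse (2 * C + of_nat (card I - 2) * (\<integral>\<^sup>+ x. b x \<partial>\<nu>))
     \<le> (\<integral>\<^sup>+ z. a (z j) / (\<Sum>i\<in>I. b (z i)) \<partial>PiM I K)" (is "_ * inverse ?d \<le> _")
    if j: "j \<in> I - {k}" for j
  proof -
    \<comment> \<open>By Fubini, coordinate \<open>j\<close> becomes the outer variable and the
      coordinates in \<open>J\<close> are integrated with it fixed. The set \<open>J - {k}\<close>
      holds the free particles other than \<open>j\<close>.\<close>
    define J where "J = I - {j}"
    have J: "I = insert j J" "j \<notin> J" "finite J" "k \<in> J" and card_J: "card (J - {k}) = card I - 2"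
      using j k fin by (auto simp: J_def card_Diff_singleton)
    interpret J: product_prob_space K J
      by unfold_locales
    have "(\<integral>\<^sup>+ x. 2 * C + (\<Sum>i\<in>J - {k}. b (x i)) \<partial>PiM J K)
        = 2 * C + (\<Sum>i\<in>J - {k}. \<integral>\<^sup>+ x. b (x i) \<partial>PiM J K)"
      by (subst nn_integral_add, simp, measurable, subst nn_integral_sum)
        (auto simp: J.P.emeasure_space_1)
    also have "(\<Sum>i\<in>J - {k}. \<integral>\<^sup>+ x. b (x i) \<partial>PiM J K) = (\<Sum>i\<in>J - {k}. \<integral>\<^sup>+ x. b x \<partial>\<nu>)"
    proof (intro sum.cong refl)
      fix i assume i: "i \<in> J - {k}"
      have "(\<integral>\<^sup>+ x. b (x i) \<partial>PiM J K) = (\<integral>\<^sup>+ x. b x \<partial>K i)"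
        using i by (intro nn_integral_PiM_component prob) auto
      with i show "(\<integral>\<^sup>+ x. b (x i) \<partial>PiM J K) = (\<integral>\<^sup>+ x. b x \<partial>\<nu>)"
        by (simp add: K)
    qed
    finally have d: "(\<integral>\<^sup>+ x. 2 * C + (\<Sum>i\<in>J - {k}. b (x i)) \<partial>PiM J K) = ?d"
      by (simp add: card_J)
    have "(\<integral>\<^sup>+ x. a x \<partial>\<nu>) * inverse ?d = (\<integral>\<^sup>+ y. a y * inverse ?d \<partial>K j)"
      using j by (subst K[of j, symmetric], simp, intro nn_integral_multc[symmetric]) measurable
    \<comment> \<open>The integrand is written with \<open>x(j := y)\<close> to match the Fubini
      rule for \<open>insert j J\<close>.\<close>
    also have "\<dots> \<le> (\<integral>\<^sup>+ y. \<integral>\<^sup>+ x. a ((x(j := y)) j) / (\<Sum>i\<in>I. b ((x(j := y)) i)) \<partial>PiM J K \<partial>K j)"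
    proof (intro nn_integral_mono)
      fix y assume y: "y \<in> space (K j)"
      have "a y * inverse ?d \<le> a y * (\<integral>\<^sup>+ x. inverse (2 * C + (\<Sum>i\<in>J - {k}. b (x i))) \<partial>PiM J K)"
        unfolding d[symmetric] by (intro mult_left_mono J.P.inverse_nn_integral_le) auto
      also have "\<dots> = (\<integral>\<^sup>+ x. a y * inverse (2 * C + (\<Sum>i\<in>J - {k}. b (x i))) \<partial>PiM J K)"
        by (intro nn_integral_cmult[symmetric]) measurable
      also have "\<dots> \<le> (\<integral>\<^sup>+ x. a ((x(j := y)) j) / (\<Sum>i\<in>I. b ((x(j := y)) i)) \<partial>PiM J K)"
      proof (intro nn_integral_mono)
        fix x assume x: "x \<in> space (PiM J K)"
        have "(\<Sum>i\<in>I. b ((x(j := y)) i)) = b y + (b (x k) + (\<Sum>i\<in>J - {k}. b (x i)))"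
        proof -
          have "(\<Sum>i\<in>J. b ((x(j := y)) i)) = (\<Sum>i\<in>J. b (x i))"
            using J(2) by (intro sum.cong) auto
          also have "\<dots> = b (x k) + (\<Sum>i\<in>J - {k}. b (x i))"
            by (rule sum.remove) fact+
          finally show ?thesis
            using J(1-3) by simp
        qed
        also have "\<dots> \<le> C + (C + (\<Sum>i\<in>J - {k}. b (x i)))"
          using x y J(4) by (intro add_mono bC order_refl) (auto simp: space_K space_PiM)
        finally have "(\<Sum>i\<in>I. b ((x(j := y)) i)) \<le> 2 * C + (\<Sum>i\<in>J - {k}. b (x i))"
          by (simp add: mult_2 add.assoc)
        then show "a y * inverse (2 * C + (\<Sum>i\<in>J - {k}. b (x i)))
            \<le> a ((x(j := y)) j) / (\<Sum>i\<in>I. b ((x(j := y)) i))"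
          by (auto simp: divide_ennreal_def intro!: mult_left_mono inverse_ennreal_antimono)
      qed
      finally show "a y * inverse ?d
          \<le> (\<integral>\<^sup>+ x. a ((x(j := y)) j) / (\<Sum>i\<in>I. b ((x(j := y)) i)) \<partial>PiM J K)" .
    qed
    also have "\<dots> = (\<integral>\<^sup>+ z. a (z j) / (\<Sum>i\<in>I. b (z i)) \<partial>PiM (insert j J) K)"
      using J by (subst product_nn_integral_insert_rev) auto
    finally show ?thesis
      using J(1) by simp
  qed
  \<comment> \<open>All \<open>card I - 1\<close> free particles contribute the same bound; the
    nonnegative numerator term of \<open>k\<close> is discarded below.\<close>
  have "of_nat (card I - 1) * (\<integral>\<^sup>+ x. a x \<partial>\<nu>) / (2 * C + of_nat (card I - 2) * (\<integral>\<^sup>+ x. b x \<partial>\<nu>))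
      = (\<Sum>j\<in>I - {k}. (\<integral>\<^sup>+ x. a x \<partial>\<nu>) * inverse (2 * C + of_nat (card I - 2) * (\<integral>\<^sup>+ x. b x \<partial>\<nu>)))"
    using fin k by (simp add: divide_ennreal_def mult.assoc card_Diff_singleton)
  also have "\<dots> \<le> (\<Sum>j\<in>I - {k}. \<integral>\<^sup>+ z. a (z j) / (\<Sum>i\<in>I. b (z i)) \<partial>PiM I K)"
    by (intro sum_mono *)
  also have "\<dots> = (\<integral>\<^sup>+ z. (\<Sum>j\<in>I - {k}. a (z j) / (\<Sum>i\<in>I. b (z i))) \<partial>PiM I K)"
    by (subst nn_integral_sum) auto
  also have "\<dots> \<le> (\<integral>\<^sup>+ z. (\<Sum>i\<in>I. a (z i)) / (\<Sum>i\<in>I. b (z i)) \<partial>PiM I K)"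
    using fin
    by (intro nn_integral_mono)
      (auto simp: divide_ennreal_def sum_distrib_right[symmetric] intro!: mult_right_mono sum_mono2)
  finally show ?thesis .
qed

text \<open>Boxes form an intersection-stable generator, and on a box the product measure is a
  finite product of measurable functions of \<open>z\<close>. This makes one generation of the
  algorithm a Markov kernel.\<close>

lemma measurable_PiM_prob_algebra:
  fixes K :: "'i \<Rightarrow> 'z \<Rightarrow> 'a measure"
  assumes fin: "finite I"
    and K: "\<And>i. K i \<in> L \<rightarrow>\<^sub>M prob_algebra S"
  shows "(\<lambda>z. PiM I (\<lambda>i. K i z)) \<in> L \<rightarrow>\<^sub>M prob_algebra (PiM I (\<lambda>_. S))"
proof (rule measurable_prob_algebra_generated[OF sets_PiM Int_stable_prod_algebra prod_algebra_sets_into_space])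
  fix z assume z: "z \<in> space L"
  have K': "prob_space (K i z)" "sets (K i z) = sets S" for i
    using measurable_space[OF K z] by (auto simp: space_prob_algebra)
  show "prob_space (PiM I (\<lambda>i. K i z))"
    by (intro prob_space_PiM K')
  show "sets (PiM I (\<lambda>i. K i z)) = sets (PiM I (\<lambda>_. S))"
    by (intro sets_PiM_cong K' refl)
next
  fix A assume "A \<in> prod_algebra I (\<lambda>_. S)"
  then obtain X where A: "A = Pi\<^sub>E I X" and X: "X \<in> (\<Pi> i\<in>I. sets S)"
    using fin by (auto simp: prod_algebra_eq_finite)
  have "emeasure (PiM I (\<lambda>i. K i z)) A = (\<Prod>i\<in>I. emeasure (K i z) (X i))"
    if z: "z \<in> space L" for z
  proof -
    have K': "prob_space (K i z)" "sets (K i z) = sets S" for i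
      using measurable_space[OF K z] by (auto simp: space_prob_algebra)
    interpret product_sigma_finite "\<lambda>i. K i z"
      using K'(1) by (auto simp: product_sigma_finite_def prob_space_imp_sigma_finite)
    show ?thesis
      unfolding A using fin X K'(2) by (intro emeasure_PiM) auto
  qed
  moreover have "(\<lambda>z. \<Prod>i\<in>I. emeasure (K i z) (X i)) \<in> borel_measurable L"
    using X by (intro borel_measurable_prod_ennreal measurable_emeasure_kernel[OF measurable_prob_algebraD[OF K]]) auto
  ultimately show "(\<lambda>z. emeasure (PiM I (\<lambda>i. K i z)) A) \<in> borel_measurable L"
    by (simp cong: measurable_cong)
qed

section \<open>Paths and kernels\<close>

lemma measurable_path_upd [measurable]:
  "(\<lambda>(p, x). p(Suc t := x)) \<in> path_space SX t \<Otimes>\<^sub>M SX \<rightarrow>\<^sub>M path_space SX (Suc t)"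
  unfolding case_prod_beta by (rule measurable_fun_upd[where J="{..t}"]) auto

lemma path_upd_in_space:
  "p \<in> space (path_space SX t) \<Longrightarrow> x \<in> space SX \<Longrightarrow> p(Suc t := x) \<in> space (path_space SX (Suc t))"
  using measurable_space[OF measurable_path_upd, of "(p, x)"] by (simp add: space_pair_measure)

lemma path_in_space: "p \<in> space (path_space SX t) \<Longrightarrow> s \<le> t \<Longrightarrow> p s \<in> space SX"
  by (auto simp: space_PiM)

lemma measurable_init_path [measurable]: "init_path \<in> SX \<rightarrow>\<^sub>M path_space SX 0"
  unfolding init_path_def by (rule measurable_fun_upd[where J="{}"]) (auto simp: space_PiM)

text \<open>\<open>measure_of\<close> returns the intended set function only once it is known to be
  countably additive, which here is the exchange of a series of nonnegative functions with the
  integral.\<close>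

lemma emeasure_kernel_comp:
  assumes K: "sets (K x) = sets SX"
    and L: "\<And>x. x \<in> space SX \<Longrightarrow> sets (L x) = sets SX"
      "\<And>A. A \<in> sets SX \<Longrightarrow> (\<lambda>x. emeasure (L x) A) \<in> borel_measurable SX"
    and A: "A \<in> sets SX"
  shows "emeasure (kernel_comp SX K L x) A = (\<integral>\<^sup>+ x'. emeasure (L x') A \<partial>K x)"
  unfolding kernel_comp_def
proof (rule emeasure_measure_of[OF refl])
  note [measurable_cong] = K
  show "countably_additive (sets (measure_of (space SX) (sets SX) (\<lambda>A. \<integral>\<^sup>+ x'. emeasure (L x') A \<partial>K x)))
     (\<lambda>A. \<integral>\<^sup>+ x'. emeasure (L x') A \<partial>K x)"
  proof (rule countably_additiveI)
    fix F :: "nat \<Rightarrow> 'a set"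
    assume F: "range F \<subseteq> sets (measure_of (space SX) (sets SX) (\<lambda>A. \<integral>\<^sup>+ x'. emeasure (L x') A \<partial>K x))"
      "disjoint_family F"
    have "(\<Sum>i. \<integral>\<^sup>+ x'. emeasure (L x') (F i) \<partial>K x) = (\<integral>\<^sup>+ x'. (\<Sum>i. emeasure (L x') (F i)) \<partial>K x)"
      using F L K by (intro nn_integral_suminf[symmetric]) (auto cong: measurable_cong_sets)
    also have "\<dots> = (\<integral>\<^sup>+ x'. emeasure (L x') (\<Union>i. F i) \<partial>K x)"
      using F L sets_eq_imp_space_eq[OF K] by (intro nn_integral_cong suminf_emeasure) auto
    finally show "(\<Sum>i. \<integral>\<^sup>+ x'. emeasure (L x') (F i) \<partial>K x) = (\<integral>\<^sup>+ x'. emeasure (L x') (\<Union>i. F i) \<partial>K x)" .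
  qed
qed (use A in \<open>auto simp: sets.space_closed positive_def\<close>)

lemma sets_kernel_comp [simp]: "sets (kernel_comp SX K L x) = sets SX"
  by (simp add: kernel_comp_def)

text \<open>The mass of a set of indices is a finite sum of normalised weights, with a separate
  value where the total weight vanishes. That value keeps the law a probability measure for every
  \<open>z\<close>, so the kernel is defined everywhere.\<close>

lemma measurable_select_index:
  assumes N: "1 \<le> N"
    and [measurable]: "\<And>j. j \<in> {1..N} \<Longrightarrow> (\<lambda>z. \<omega> z j) \<in> borel_measurable L"
    and nonneg: "\<And>z j. z \<in> space L \<Longrightarrow> j \<in> {1..N} \<Longrightarrow> 0 \<le> \<omega> z j"
  shows "(\<lambda>z. select_index N (\<omega> z)) \<in> L \<rightarrow>\<^sub>M prob_algebra (count_space {1..N})"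
proof -
  have eq: "emeasure (select_index N (\<omega> z)) A =
      (if (\<Sum>j=1..N. \<omega> z j) = 0 then indicator A N
       else \<Sum>i\<in>A. ennreal (\<omega> z i / (\<Sum>j=1..N. \<omega> z j)))" if "A \<subseteq> {1..N}" for A z
    using that N by (auto simp: select_index_def emeasure_point_measure_finite)
  have sets: "sets (select_index N (\<omega> z)) = sets (count_space {1..N})" for z
    by (auto simp: select_index_def sets_point_measure)
  have prob: "prob_space (select_index N (\<omega> z))" if z: "z \<in> space L" for z
  proof (rule prob_spaceI)
    have "(\<Sum>i=1..N. ennreal (\<omega> z i / (\<Sum>j=1..N. \<omega> z j))) = 1" if "(\<Sum>j=1..N. \<omega> z j) \<noteq> 0"
    proof -
      have "(\<Sum>i=1..N. ennreal (\<omega> z i / (\<Sum>j=1..N. \<omega> z j))) = ennreal (\<Sum>i=1..N. \<omega> z i / (\<Sum>j=1..N. \<omega> z j))"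
        using z by (intro sum_ennreal divide_nonneg_nonneg sum_nonneg nonneg) auto
      then show ?thesis
        using that by (simp add: sum_divide_distrib[symmetric])
    qed
    then show "emeasure (select_index N (\<omega> z)) (space (select_index N (\<omega> z))) = 1"
      using N sets_eq_imp_space_eq[OF sets] by (simp add: eq)
  qed
  show ?thesis
  proof (rule measurable_prob_algebraI[OF prob measurable_subprob_algebra])
    fix A assume "A \<in> sets (count_space {1..N})"
    then have A: "A \<subseteq> {1..N}" by simp
    then have [measurable]: "\<And>i. i \<in> A \<Longrightarrow> (\<lambda>z. \<omega> z i) \<in> borel_measurable L"
      by auto
    show "(\<lambda>z. emeasure (select_index N (\<omega> z)) A) \<in> borel_measurable L"
      unfolding eq[OF A] by measurable
  qed (auto simp: sets prob prob_space_imp_subprob_space)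
qed

section \<open>The model, its standing assumptions and its backward operators\<close>

locale particle_gibbs_model =
  fixes SX :: "'a measure" and SY :: "'b measure"
    and M :: "'a \<Rightarrow> 'a measure" and g :: "'a \<Rightarrow> 'b \<Rightarrow> real" and \<mu> :: "'a measure"
    and Y :: "nat \<Rightarrow> 'b"
    and r0 :: "'b \<Rightarrow> 'a measure" and R :: "'b \<Rightarrow> 'a \<Rightarrow> 'a measure"
    and w0 :: "'b \<Rightarrow> 'a \<Rightarrow> real" and w :: "'b \<Rightarrow> 'a \<Rightarrow> 'a \<Rightarrow> real"
    and N T :: nat and xref :: "nat \<Rightarrow> 'a"
  assumes M_kernel: "M \<in> SX \<rightarrow>\<^sub>M prob_algebra SX"
    and g_measurable: "(\<lambda>(x, y). g x y) \<in> borel_measurable (SX \<Otimes>\<^sub>M SY)"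
    and mu_prob: "\<mu> \<in> space (prob_algebra SX)"
    and Y_space: "\<And>t. t \<le> T \<Longrightarrow> Y t \<in> space SY"
    and likelihood_pos: "\<And>t. t \<le> T \<Longrightarrow> 0 < likelihood \<mu> M g Y t"
    and likelihood_finite: "\<And>t. t \<le> T \<Longrightarrow> likelihood \<mu> M g Y t < \<infinity>"
    and r0_prob: "\<And>y. y \<in> space SY \<Longrightarrow> r0 y \<in> space (prob_algebra SX)"
    and r0_ac: "\<And>y. y \<in> space SY \<Longrightarrow> absolutely_continuous (r0 y) \<mu>"
    and R_kernel: "\<And>y. y \<in> space SY \<Longrightarrow> R y \<in> SX \<rightarrow>\<^sub>M prob_algebra SX"
    and R_ac: "\<And>y x. y \<in> space SY \<Longrightarrow> x \<in> space SX \<Longrightarrow>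
                 absolutely_continuous (R y x) (Q_kernel M g y x)"
    and w0_measurable: "\<And>y. y \<in> space SY \<Longrightarrow> w0 y \<in> borel_measurable SX"
    and w0_nonneg: "\<And>y x. y \<in> space SY \<Longrightarrow> x \<in> space SX \<Longrightarrow> 0 \<le> w0 y x"
    and w0_version: "\<And>y. y \<in> space SY \<Longrightarrow>
                       AE x in r0 y. ennreal (w0 y x) = ennreal (g x y) * RN_deriv (r0 y) \<mu> x"
    and w_measurable: "\<And>y. y \<in> space SY \<Longrightarrow>
                         (\<lambda>(x, x'). w y x x') \<in> borel_measurable (SX \<Otimes>\<^sub>M SX)"
    and w_nonneg: "\<And>y x x'. y \<in> space SY \<Longrightarrow> x \<in> space SX \<Longrightarrow> x' \<in> space SX \<Longrightarrow> 0 \<le> w y x x'"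
    and w_version: "\<And>y x. y \<in> space SY \<Longrightarrow> x \<in> space SX \<Longrightarrow>
                      AE x' in R y x. ennreal (w y x x') = RN_deriv (R y x) (Q_kernel M g y x) x'"
    and N_ge_2: "2 \<le> N"
    and xref: "xref \<in> space (path_space SX T)"
begin

abbreviation path_int :: "nat \<Rightarrow> ((nat \<Rightarrow> 'a) \<Rightarrow> ennreal) \<Rightarrow> ennreal" where
  "path_int \<equiv> path_integral \<mu> M g Y"

abbreviation W :: "nat \<Rightarrow> (nat \<Rightarrow> 'a) \<Rightarrow> real" where
  "W \<equiv> weight w0 w Y"

abbreviation Wnorm :: "nat \<Rightarrow> ennreal" where
  "Wnorm \<equiv> weight_norm SX w0 w Y"

abbreviation system_space :: "nat \<Rightarrow> (nat \<Rightarrow> nat \<Rightarrow> 'a) measure" where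
  "system_space t \<equiv> PiM {1..N} (\<lambda>_. path_space SX t)"

definition Q_op :: "nat \<Rightarrow> ('a \<Rightarrow> ennreal) \<Rightarrow> 'a \<Rightarrow> ennreal" where
  "Q_op t h x = (\<integral>\<^sup>+ x'. ennreal (g x' (Y t)) * h x' \<partial>M x)"

text \<open>The innermost integral of \<open>path_integral\<close>, as an operator on functions of
  whole paths: the lift of \<open>Q_op (Suc t)\<close> from states to paths.\<close>

definition path_op :: "nat \<Rightarrow> ((nat \<Rightarrow> 'a) \<Rightarrow> ennreal) \<Rightarrow> (nat \<Rightarrow> 'a) \<Rightarrow> ennreal" where
  "path_op t f p = (\<integral>\<^sup>+ x. ennreal (g x (Y (Suc t))) * f (p(Suc t := x)) \<partial>M (p t))"

text \<open>\<open>mass l t\<close> is \<open>Q\<langle>Y\<^sub>t\<^sub>+\<^sub>1\<^sub>:\<^sub>t\<^sub>+\<^sub>l\<rangle>1\<close>.\<close>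

primrec mass :: "nat \<Rightarrow> nat \<Rightarrow> 'a \<Rightarrow> ennreal" where
  "mass 0 t = (\<lambda>_. 1)"
| "mass (Suc l) t = Q_op (Suc t) (mass l (Suc t))"

section \<open>Linearity and telescoping of path integrals\<close>

lemma path_int_Suc: "path_int (Suc t) f = path_int t (path_op t f)"
  by (simp add: path_op_def[abs_def])

lemma path_op_last: "path_op t (\<lambda>p. h (p (Suc t))) p = Q_op (Suc t) h (p t)"
  by (simp add: path_op_def Q_op_def)

lemma path_int_Suc_last:
  "path_int (Suc t) (\<lambda>p. h (p (Suc t))) = path_int t (\<lambda>p. Q_op (Suc t) h (p t))"
  unfolding path_int_Suc by (rule arg_cong[where f="path_int t"]) (rule ext, rule path_op_last)

lemma M_space:
  assumes "x \<in> space SX"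
  shows "prob_space (M x)" "sets (M x) = sets SX" "space (M x) = space SX"
  using measurable_space[OF M_kernel assms] by (auto simp: space_prob_algebra dest: sets_eq_imp_space_eq)

lemma mu_space: "prob_space \<mu>" "sets \<mu> = sets SX" "space \<mu> = space SX"
  using mu_prob by (auto simp: space_prob_algebra dest: sets_eq_imp_space_eq)

lemma M_subprob [measurable]: "M \<in> SX \<rightarrow>\<^sub>M subprob_algebra SX"
  by (rule measurable_prob_algebraD[OF M_kernel])

lemma measurable_g [measurable]: "t \<le> T \<Longrightarrow> (\<lambda>x. g x (Y t)) \<in> borel_measurable SX"
  using measurable_compose[OF measurable_Pair2'[OF Y_space] g_measurable] by simp

lemma measurable_path_op [measurable]:
  assumes t: "Suc t \<le> T" and [measurable]: "f \<in> borel_measurable (path_space SX (Suc t))"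
  shows "path_op t f \<in> borel_measurable (path_space SX t)"
proof -
  note [measurable] = measurable_g[OF t]
  have [measurable]: "(\<lambda>x. f ((fst x)(Suc t := snd x))) \<in> borel_measurable (path_space SX t \<Otimes>\<^sub>M SX)"
    using measurable_compose[OF measurable_path_upd assms(2)] by (simp add: case_prod_beta)
  show ?thesis
    unfolding path_op_def[abs_def]
  proof (rule nn_integral_measurable_subprob_algebra2)
    show "(\<lambda>p. M (p t)) \<in> path_space SX t \<rightarrow>\<^sub>M subprob_algebra SX"
      by (rule measurable_compose[OF _ M_subprob]) simp
  qed (simp add: case_prod_beta)
qed

lemma measurable_Q_op [measurable]:
  assumes t: "t \<le> T" and [measurable]: "h \<in> borel_measurable SX"
  shows "Q_op t h \<in> borel_measurable SX"
proof -
  note [measurable] = measurable_g[OF t]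
  show ?thesis
    unfolding Q_op_def[abs_def] by (rule nn_integral_measurable_subprob_algebra2[OF _ M_subprob]) measurable
qed

lemma measurable_mass: "t + l \<le> T \<Longrightarrow> mass l t \<in> borel_measurable SX"
  by (induction l arbitrary: t) auto

lemma path_op_cong:
  assumes "\<And>p. p \<in> space (path_space SX (Suc t)) \<Longrightarrow> f p = f' p" and p: "p \<in> space (path_space SX t)"
  shows "path_op t f p = path_op t f' p"
  unfolding path_op_def
  using path_upd_in_space[OF p] by (intro nn_integral_cong) (simp add: M_space path_in_space[OF p] assms(1))

lemma path_int_cong:
  "(\<And>p. p \<in> space (path_space SX t) \<Longrightarrow> f p = f' p) \<Longrightarrow> path_int t f = path_int t f'"
proof (induction t arbitrary: f f')
  case 0
  have "f (init_path x) = f' (init_path x)" if "x \<in> space \<mu>" for x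
    using that by (intro 0 measurable_space[OF measurable_init_path]) (simp add: mu_space)
  then show ?case
    by (auto intro!: nn_integral_cong)
next
  case (Suc t)
  then show ?case
    unfolding path_int_Suc by (intro Suc.IH path_op_cong)
qed

lemma path_op_add:
  assumes t: "Suc t \<le> T" and "f \<in> borel_measurable (path_space SX (Suc t))"
      "f' \<in> borel_measurable (path_space SX (Suc t))"
    and p: "p \<in> space (path_space SX t)"
  shows "path_op t (\<lambda>p. c * f p + c' * f' p) p = c * path_op t f p + c' * path_op t f' p"
proof -
  note [measurable] = measurable_g[OF t]
  have upd: "(\<lambda>x. p(Suc t := x)) \<in> SX \<rightarrow>\<^sub>M path_space SX (Suc t)"
    using measurable_compose[OF measurable_Pair1'[OF p] measurable_path_upd] by simp
  have meas: "(\<lambda>x. ennreal (g x (Y (Suc t))) * f (p(Suc t := x))) \<in> borel_measurable (M (p t))"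
    if "f \<in> borel_measurable (path_space SX (Suc t))" for f
  proof -
    note [measurable] = measurable_compose[OF upd that]
    have "(\<lambda>x. ennreal (g x (Y (Suc t))) * f (p(Suc t := x))) \<in> borel_measurable SX"
      by measurable
    then show ?thesis
      by (simp add: measurable_cong_sets[OF M_space(2)[OF path_in_space[OF p order_refl]] refl])
  qed
  note m = meas[OF assms(2)] meas[OF assms(3)]
  show ?thesis
    unfolding path_op_def distrib_left mult.left_commute[of _ c] mult.left_commute[of _ c']
    by (simp only: nn_integral_cmult[OF m(1)] nn_integral_cmult[OF m(2)]
        nn_integral_add[OF borel_measurable_times_ennreal[OF borel_measurable_const m(1)]
          borel_measurable_times_ennreal[OF borel_measurable_const m(2)]])
qed

lemma path_int_add:
  "t \<le> T \<Longrightarrow> f \<in> borel_measurable (path_space SX t) \<Longrightarrow> f' \<in> borel_measurable (path_space SX t) \<Longrightarrow>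
    path_int t (\<lambda>p. c * f p + c' * f' p) = c * path_int t f + c' * path_int t f'"
proof (induction t arbitrary: f f')
  case 0
  note [measurable] = measurable_g[OF 0(1)] 0(2,3)
  note [measurable_cong] = mu_space(2)
  show ?case
    unfolding path_integral.simps distrib_left mult.left_commute[of _ c] mult.left_commute[of _ c']
    by (subst nn_integral_add; (subst nn_integral_cmult)?) (auto simp: nn_integral_cmult)
next
  case (Suc t)
  \<comment> \<open>\<open>path_op_add\<close> holds only at genuine paths, so it enters through the
    congruence rule for \<open>path_int\<close>.\<close>
  then have "path_int t (path_op t (\<lambda>p. c * f p + c' * f' p)) =
      path_int t (\<lambda>p. c * path_op t f p + c' * path_op t f' p)"
    by (intro path_int_cong path_op_add)
  with Suc show ?case
    unfolding path_int_Suc by (simp add: measurable_path_op)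
qed

lemma path_int_sum:
  assumes "t \<le> T" "finite L" "\<And>l. l \<in> L \<Longrightarrow> f l \<in> borel_measurable (path_space SX t)"
  shows "path_int t (\<lambda>p. \<Sum>l\<in>L. c l * f l p) = (\<Sum>l\<in>L. c l * path_int t (f l))"
  using assms(2,3)
proof (induction L)
  case empty
  \<comment> \<open>Two zero coefficients in \<open>path_int_add\<close> show that the integral of 0
    is 0.\<close>
  show ?case
    using path_int_add[of t "\<lambda>_. 0" "\<lambda>_. 0" 0 0] assms(1) by simp
next
  case (insert l L)
  have "(\<lambda>p. \<Sum>l\<in>L. c l * f l p) \<in> borel_measurable (path_space SX t)"
    using insert.prems by (intro borel_measurable_sum borel_measurable_times_ennreal) auto
  with insert path_int_add[OF assms(1), of "f l" "\<lambda>p. \<Sum>l\<in>L. c l * f l p" "c l" 1]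
  show ?case by simp
qed

text \<open>Absorbing the first kernel of \<open>mass\<close> into the path integral lengthens the
  path by one and shortens \<open>mass\<close> by one, so \<open>t + l\<close> is invariant until
  \<open>mass\<close> is the constant 1.\<close>

lemma path_int_mass: "path_int t (\<lambda>p. mass l t (p t)) = likelihood \<mu> M g Y (t + l)"
proof (induction l arbitrary: t)
  case 0
  show ?case by (simp add: likelihood_def)
next
  case (Suc l)
  show ?case
    using Suc.IH[of "Suc t"] by (simp add: path_int_Suc_last del: path_integral.simps)
qed

section \<open>Iterated kernels and their total mass\<close>

lemma Q_kernel_kernel:
  assumes t: "t \<le> T" and x: "x \<in> space SX"
  shows "sets (Q_kernel M g (Y t) x) = sets SX"
    and "f \<in> borel_measurable SX \<Longrightarrow> (\<integral>\<^sup>+ x'. f x' \<partial>Q_kernel M g (Y t) x) = Q_op t f x"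
proof -
  show "sets (Q_kernel M g (Y t) x) = sets SX"
    by (simp add: Q_kernel_def M_space x)
  assume "f \<in> borel_measurable SX"
  then show "(\<integral>\<^sup>+ x'. f x' \<partial>Q_kernel M g (Y t) x) = Q_op t f x"
    unfolding Q_kernel_def Q_op_def using measurable_g[OF t] M_space(2)[OF x]
    by (subst nn_integral_density) (auto cong: measurable_cong_sets)
qed

lemma Q_comp_Suc:
  "Q_comp SX M g Y (Suc t) (t + Suc l) =
    kernel_comp SX (Q_kernel M g (Y (Suc t))) (Q_comp SX M g Y (Suc (Suc t)) (Suc t + l))"
  unfolding Q_comp_def by (subst upt_conv_Cons) auto

text \<open>The three claims share one induction: evaluating \<open>kernel_comp\<close> requires the
  right sets and measurability of the remaining composition. Peeling the first kernel off matches
  the recursion of \<open>mass\<close>.\<close>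

lemma Q_comp_kernel:
  assumes "t + l \<le> T"
  shows "x \<in> space SX \<Longrightarrow> sets (Q_comp SX M g Y (Suc t) (t + l) x) = sets SX"
    and "A \<in> sets SX \<Longrightarrow> (\<lambda>x. emeasure (Q_comp SX M g Y (Suc t) (t + l) x) A) \<in> borel_measurable SX"
    and "x \<in> space SX \<Longrightarrow> emeasure (Q_comp SX M g Y (Suc t) (t + l) x) (space SX) = mass l t x"
  using assms
proof (induction l arbitrary: t x A)
  \<comment> \<open>Here the list of kernels is empty and the composition is
    \<open>return SX\<close>.\<close>
  case 0
  {
    case 1 then show ?case by (simp add: Q_comp_def)
  next
    case 2 then show ?case by (simp add: Q_comp_def)
  next
    case 3 then show ?case by (simp add: Q_comp_def)
  }
next
  case (Suc l)
  have le: "Suc t + l \<le> T" "Suc t \<le> T" if "t + Suc l \<le> T" for t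
    using that by auto
  \<comment> \<open>A general \<open>A\<close> serves measurability; \<open>A = space SX\<close>
    gives the recursion for the total mass.\<close>
  have em: "emeasure (Q_comp SX M g Y (Suc t) (t + Suc l) x) A =
      Q_op (Suc t) (\<lambda>x. emeasure (Q_comp SX M g Y (Suc (Suc t)) (Suc t + l) x) A) x"
    if "A \<in> sets SX" "x \<in> space SX" "t + Suc l \<le> T" for A x t
    unfolding Q_comp_Suc using that le[OF that(3)]
    by (subst emeasure_kernel_comp) (auto simp: Q_kernel_kernel Suc.IH(1,2) simp del: add_Suc)
  {
    case 1 show ?case by (simp only: Q_comp_Suc sets_kernel_comp)
  next
    case 2
    have "Q_op (Suc t) (\<lambda>x. emeasure (Q_comp SX M g Y (Suc (Suc t)) (Suc t + l) x) A) \<in> borel_measurable SX"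
      using 2 by (intro measurable_Q_op Suc.IH) auto
    then show ?case
      using 2 by (subst measurable_cong[OF em]) auto
  next
    case 3
    then show ?case
      by (subst em) (auto simp: Q_op_def M_space Suc.IH(3) simp del: add_Suc intro!: nn_integral_cong)
  }
qed

lemma kernel_apply_Q_comp:
  assumes "t + l \<le> T" "x \<in> space SX"
  shows "kernel_apply (Q_comp SX M g Y (t + 1) (t + l)) (\<lambda>_. 1) x = mass l t x"
  using Q_comp_kernel(3)[OF assms] sets_eq_imp_space_eq[OF Q_comp_kernel(1)[OF assms]]
  by (simp add: kernel_apply_def)

subsection \<open>The particle system\<close>

lemma weight_0: "W 0 p = w0 (Y 0) (p 0)"
  by (simp add: weight_def)

lemma weight_Suc: "W (Suc t) p = w (Y (Suc t)) (p t) (p (Suc t))"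
  by (simp add: weight_def)

lemma weight_nonneg: "t \<le> T \<Longrightarrow> p \<in> space (path_space SX t) \<Longrightarrow> 0 \<le> W t p"
  unfolding weight_def using path_in_space[of p t SX] by (auto intro!: w0_nonneg w_nonneg Y_space)

lemma measurable_weight [measurable]: "t \<le> T \<Longrightarrow> W t \<in> borel_measurable (path_space SX t)"
proof (cases t)
  case 0
  assume "t \<le> T"
  then show ?thesis
    unfolding 0 weight_0[abs_def] by (intro measurable_compose[OF _ w0_measurable[OF Y_space]]) auto
next
  case (Suc s)
  assume "t \<le> T"
  then have "(\<lambda>p. (p s, p (Suc s))) \<in> path_space SX t \<rightarrow>\<^sub>M SX \<Otimes>\<^sub>M SX"
    by (intro measurable_Pair measurable_component_singleton) (auto simp: Suc)
  from measurable_compose[OF this w_measurable[OF Y_space[OF \<open>t \<le> T\<close>]]] show ?thesis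
    by (simp add: Suc weight_Suc[abs_def])
qed

lemma weight_le_norm: "p \<in> space (path_space SX t) \<Longrightarrow> ennreal (W t p) \<le> Wnorm t"
  unfolding weight_def weight_norm_def using path_in_space[of p t SX]
  by (auto intro!: SUP_upper SUP_upper2[of "p (t - Suc 0)"])

text \<open>The importance sampling identity: \<open>w\<close> is a version of the density of the
  kernel Q with respect to the proposal, so weighting the proposal undoes the change of
  measure.\<close>

lemma nn_integral_R_weight:
  assumes t: "t \<le> T" and x: "x \<in> space SX" and [measurable]: "f \<in> borel_measurable SX"
  shows "(\<integral>\<^sup>+ x'. ennreal (w (Y t) x x') * f x' \<partial>R (Y t) x) = Q_op t f x"
proof -
  have R: "prob_space (R (Y t) x)" "sets (R (Y t) x) = sets SX"
    using measurable_space[OF R_kernel[OF Y_space[OF t]] x] by (auto simp: space_prob_algebra)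
  interpret prob_space "R (Y t) x" by fact
  have f: "f \<in> borel_measurable (R (Y t) x)"
    by (simp add: measurable_cong_sets[OF R(2) refl])
  have "(\<integral>\<^sup>+ x'. ennreal (w (Y t) x x') * f x' \<partial>R (Y t) x) =
      (\<integral>\<^sup>+ x'. RN_deriv (R (Y t) x) (Q_kernel M g (Y t) x) x' * f x' \<partial>R (Y t) x)"
    using w_version[OF Y_space[OF t] x] by (intro nn_integral_cong_AE) auto
  also have "\<dots> = (\<integral>\<^sup>+ x'. f x' \<partial>Q_kernel M g (Y t) x)"
    using f R(2) Q_kernel_kernel(1)[OF t x]
    by (subst density_RN_deriv[OF R_ac[OF Y_space[OF t] x], symmetric])
      (auto simp: nn_integral_density)
  finally show ?thesis
    by (simp add: Q_kernel_kernel(2)[OF t x])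
qed

text \<open>The same identity at time 0, where the density concerns only \<open>\<mu>\<close> and
  the factor \<open>g\<close> is carried along as part of the integrand.\<close>

lemma nn_integral_r0_weight:
  assumes [measurable]: "f \<in> borel_measurable SX"
  shows "(\<integral>\<^sup>+ x. ennreal (w0 (Y 0) x) * f x \<partial>r0 (Y 0)) = (\<integral>\<^sup>+ x. ennreal (g x (Y 0)) * f x \<partial>\<mu>)"
proof -
  have r0: "prob_space (r0 (Y 0))" "sets (r0 (Y 0)) = sets SX"
    using r0_prob[OF Y_space[of 0]] by (auto simp: space_prob_algebra)
  interpret prob_space "r0 (Y 0)" by fact
  have "(\<lambda>x. ennreal (g x (Y 0)) * f x) \<in> borel_measurable SX"
    by measurable
  then have gf: "(\<lambda>x. ennreal (g x (Y 0)) * f x) \<in> borel_measurable (r0 (Y 0))"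
    by (simp add: measurable_cong_sets[OF r0(2) refl])
  have "(\<integral>\<^sup>+ x. ennreal (w0 (Y 0) x) * f x \<partial>r0 (Y 0)) =
      (\<integral>\<^sup>+ x. RN_deriv (r0 (Y 0)) \<mu> x * (ennreal (g x (Y 0)) * f x) \<partial>r0 (Y 0))"
    using w0_version[OF Y_space[of 0]] by (intro nn_integral_cong_AE) (auto simp: mult_ac)
  also have "\<dots> = (\<integral>\<^sup>+ x. ennreal (g x (Y 0)) * f x \<partial>\<mu>)"
    using gf r0(2) mu_space(2)
    by (subst (2) density_RN_deriv[OF r0_ac[OF Y_space[of 0]], symmetric])
      (auto simp: nn_integral_density)
  finally show ?thesis .
qed

lemma system_component:
  "z \<in> space (system_space t) \<Longrightarrow> j \<in> {1..N} \<Longrightarrow> z j \<in> space (path_space SX t)"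
  by (rule measurable_space[OF measurable_component_singleton])

text \<open>Given the generation \<open>z\<close>, the free particles of the next one are i.i.d.;
  this is their common law, parent selection followed by mutation.\<close>

definition offspring :: "nat \<Rightarrow> (nat \<Rightarrow> nat \<Rightarrow> 'a) \<Rightarrow> (nat \<Rightarrow> 'a) measure" where
  "offspring t z = select_index N (\<lambda>j. W t (z j)) \<bind>
     (\<lambda>a. distr (R (Y (Suc t)) (z a t)) (path_space SX (Suc t)) (\<lambda>x. (z a)(Suc t := x)))"

lemma measurable_select_weight:
  assumes t: "t \<le> T"
  shows "(\<lambda>z. select_index N (\<lambda>j. W t (z j))) \<in> system_space t \<rightarrow>\<^sub>M prob_algebra (count_space {1..N})"
proof (rule measurable_select_index)
  note [measurable] = measurable_weight[OF t]
  show "(\<lambda>z. W t (z j)) \<in> borel_measurable (system_space t)" if "j \<in> {1..N}" for j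
    using that by measurable
  show "0 \<le> W t (z j)" if "z \<in> space (system_space t)" "j \<in> {1..N}" for z j
    by (rule weight_nonneg[OF t system_component[OF that]])
qed (use N_ge_2 in simp)

lemma measurable_offspring_distr:
  assumes t: "Suc t \<le> T" and j: "j \<in> {1..N}"
  shows "(\<lambda>z. distr (R (Y (Suc t)) (z j t)) (path_space SX (Suc t)) (\<lambda>x. (z j)(Suc t := x)))
    \<in> system_space t \<rightarrow>\<^sub>M prob_algebra (path_space SX (Suc t))"
proof (rule measurable_distr_prob_space2)
  have z [measurable]: "(\<lambda>z. z j) \<in> system_space t \<rightarrow>\<^sub>M path_space SX t"
    using j by (rule measurable_component_singleton)
  have "(\<lambda>z. z j t) \<in> system_space t \<rightarrow>\<^sub>M SX"
    by (rule measurable_compose[OF z]) simp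
  then show "(\<lambda>z. R (Y (Suc t)) (z j t)) \<in> system_space t \<rightarrow>\<^sub>M prob_algebra SX"
    by (rule measurable_compose[OF _ R_kernel[OF Y_space[OF t]]])
  have "(\<lambda>(z, x). (z j, x)) \<in> system_space t \<Otimes>\<^sub>M SX \<rightarrow>\<^sub>M path_space SX t \<Otimes>\<^sub>M SX"
    by measurable
  from measurable_compose[OF this measurable_path_upd]
  show "(\<lambda>(z, x). (z j)(Suc t := x)) \<in> system_space t \<Otimes>\<^sub>M SX \<rightarrow>\<^sub>M path_space SX (Suc t)"
    by (simp add: case_prod_beta)
qed

text \<open>The index of the parent takes finitely many values, so joint measurability in system and
  index reduces to each fixed index.\<close>

lemma measurable_offspring:
  assumes t: "Suc t \<le> T"
  shows "offspring t \<in> system_space t \<rightarrow>\<^sub>M prob_algebra (path_space SX (Suc t))"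
  unfolding offspring_def[abs_def]
proof (rule measurable_bind_prob_space2[OF measurable_select_weight])
  have "(\<lambda>x. distr (R (Y (Suc t)) (fst x (snd x) t)) (path_space SX (Suc t)) (\<lambda>y. (fst x (snd x))(Suc t := y)))
    \<in> system_space t \<Otimes>\<^sub>M count_space {1..N} \<rightarrow>\<^sub>M prob_algebra (path_space SX (Suc t))"
    by (rule measurable_compose_countable'[where g=snd and I="{1..N}" and
        f="\<lambda>a x. distr (R (Y (Suc t)) (fst x a t)) (path_space SX (Suc t)) (\<lambda>y. (fst x a)(Suc t := y))"])
      (rule measurable_compose[OF measurable_fst measurable_offspring_distr[OF t]], simp_all)
  then show "(\<lambda>(z, a). distr (R (Y (Suc t)) (z a t)) (path_space SX (Suc t)) (\<lambda>x. (z a)(Suc t := x)))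
    \<in> system_space t \<Otimes>\<^sub>M count_space {1..N} \<rightarrow>\<^sub>M prob_algebra (path_space SX (Suc t))"
    by (simp add: case_prod_beta)
qed (use t in simp)

text \<open>Selection averages over parents with normalised weights, and for each parent the
  weighted proposal integrates like Q, which yields \<open>path_op\<close>.\<close>

lemma nn_integral_offspring:
  assumes t: "Suc t \<le> T" and z: "z \<in> space (system_space t)"
    and [measurable]: "f \<in> borel_measurable (path_space SX (Suc t))"
    and pos: "(\<Sum>j=1..N. W t (z j)) \<noteq> 0"
  shows "(\<integral>\<^sup>+ p. ennreal (W (Suc t) p) * f p \<partial>offspring t z) =
    (\<Sum>j=1..N. ennreal (W t (z j)) * path_op t f (z j)) / ennreal (\<Sum>j=1..N. W t (z j))"
proof -
  note [measurable] = measurable_weight[OF t]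
  let ?s = "\<Sum>j=1..N. W t (z j)"
  let ?F = "\<lambda>p. ennreal (W (Suc t) p) * f p"
  let ?K = "\<lambda>a. distr (R (Y (Suc t)) (z a t)) (path_space SX (Suc t)) (\<lambda>x. (z a)(Suc t := x))"
  have zj: "z j \<in> space (path_space SX t)" if "j \<in> {1..N}" for j
    by (rule system_component[OF z that])
  have W: "0 \<le> W t (z j)" if "j \<in> {1..N}" for j
    using t zj[OF that] by (simp add: weight_nonneg)
  have "0 \<le> ?s"
    by (intro sum_nonneg W)
  then have s: "0 < ?s"
    using pos by (simp only: less_le) simp
  have K: "?K \<in> count_space {1..N} \<rightarrow>\<^sub>M subprob_algebra (path_space SX (Suc t))"
    using measurable_space[OF measurable_prob_algebraD[OF measurable_offspring_distr[OF t]] z]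
    by (auto simp del: atMost_Suc)
  \<comment> \<open>The new weight sees only the parent's last state and the new state, so the
    importance sampling identity applies with the parent's path fixed.\<close>
  have *: "(\<integral>\<^sup>+ p. ?F p \<partial>?K j) = path_op t f (z j)" if j: "j \<in> {1..N}" for j
  proof -
    have upd: "(\<lambda>x. (z j)(Suc t := x)) \<in> SX \<rightarrow>\<^sub>M path_space SX (Suc t)"
      using measurable_compose[OF measurable_Pair1'[OF zj[OF j]] measurable_path_upd] by simp
    have x: "z j t \<in> space SX"
      using path_in_space[OF zj[OF j]] by simp
    have R: "sets (R (Y (Suc t)) (z j t)) = sets SX"
      using measurable_space[OF R_kernel[OF Y_space[OF t]] x] by (auto simp: space_prob_algebra)
    have "(\<integral>\<^sup>+ p. ?F p \<partial>?K j) = (\<integral>\<^sup>+ x. ?F ((z j)(Suc t := x)) \<partial>R (Y (Suc t)) (z j t))"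
      using upd by (intro nn_integral_distr) (auto simp: measurable_cong_sets[OF R refl] simp del: atMost_Suc)
    also have "\<dots> = Q_op (Suc t) (\<lambda>x. f ((z j)(Suc t := x))) (z j t)"
      using nn_integral_R_weight[OF t x measurable_compose[OF upd assms(3)]] by (simp add: weight_Suc)
    finally show ?thesis
      by (simp add: Q_op_def path_op_def)
  qed
  have sel: "select_index N (\<lambda>j. W t (z j)) = point_measure {1..N} (\<lambda>i. ennreal (W t (z i) / ?s))"
    using pos by (simp add: select_index_def)
  have "(\<integral>\<^sup>+ p. ?F p \<partial>offspring t z) = (\<integral>\<^sup>+ a. (\<integral>\<^sup>+ p. ?F p \<partial>?K a) \<partial>select_index N (\<lambda>j. W t (z j)))"
    unfolding offspring_def
  proof (rule nn_integral_bind)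
    show "?F \<in> borel_measurable (path_space SX (Suc t))"
      by measurable
    show "?K \<in> select_index N (\<lambda>j. W t (z j)) \<rightarrow>\<^sub>M subprob_algebra (path_space SX (Suc t))"
      unfolding sel using K by (simp add: measurable_cong_sets[OF _ refl, of "point_measure _ _" "count_space {1..N}"] sets_point_measure del: atMost_Suc)
  qed
  also have "\<dots> = (\<Sum>j=1..N. ennreal (W t (z j) / ?s) * path_op t f (z j))"
    unfolding sel by (subst nn_integral_point_measure_finite) (auto simp: * simp del: atMost_Suc)
  also have "\<dots> = (\<Sum>j=1..N. ennreal (W t (z j)) * path_op t f (z j) / ennreal ?s)"
    using s W by (intro sum.cong refl) (simp add: divide_ennreal[symmetric] divide_ennreal_def mult_ac)
  finally show ?thesis
    by (simp add: divide_ennreal_def sum_distrib_right)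
qed

lemma pg_step_eq:
  "pg_step SX R w0 w N Y xref t z = PiM {1..N} (\<lambda>i.
     if i = N then return (path_space SX (Suc t)) ((z N)(Suc t := xref (Suc t))) else offspring t z)"
  unfolding pg_step_def offspring_def ..

lemma measurable_pg_step_component:
  assumes t: "Suc t \<le> T"
  shows "(\<lambda>z. if i = N then return (path_space SX (Suc t)) ((z N)(Suc t := xref (Suc t))) else offspring t z)
    \<in> system_space t \<rightarrow>\<^sub>M prob_algebra (path_space SX (Suc t))"
proof -
  have "(\<lambda>z. (z N)(Suc t := xref (Suc t))) \<in> system_space t \<rightarrow>\<^sub>M path_space SX (Suc t)"
    using N_ge_2 path_in_space[OF xref t] by (intro measurable_fun_upd[where J="{..t}"]) auto
  then show ?thesis
    using measurable_offspring[OF t]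
    by (cases "i = N") (auto intro: measurable_compose[OF _ measurable_return_prob_space] simp del: atMost_Suc)
qed

lemma measurable_pg_step:
  "Suc t \<le> T \<Longrightarrow> pg_step SX R w0 w N Y xref t \<in> system_space t \<rightarrow>\<^sub>M prob_algebra (system_space (Suc t))"
  unfolding pg_step_eq[abs_def] by (intro measurable_PiM_prob_algebra measurable_pg_step_component) auto

lemma pg_init_component:
  "(if i = N then return (path_space SX 0) (init_path (xref 0))
    else distr (r0 (Y 0)) (path_space SX 0) init_path) \<in> space (prob_algebra (path_space SX 0))"
proof -
  have r0: "prob_space (r0 (Y 0))" "sets (r0 (Y 0)) = sets SX"
    using r0_prob[OF Y_space[of 0]] by (auto simp: space_prob_algebra)
  have "init_path (xref 0) \<in> space (path_space SX 0)"
    by (intro measurable_space[OF measurable_init_path] path_in_space[OF xref]) simp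
  moreover have "prob_space (distr (r0 (Y 0)) (path_space SX 0) init_path)"
    using r0 measurable_init_path by (intro prob_space.prob_space_distr) (auto cong: measurable_cong_sets)
  ultimately show ?thesis
    by (auto simp: space_prob_algebra prob_space_return)
qed

lemma pg_law_space:
  "t \<le> T \<Longrightarrow> pg_law SX r0 R w0 w N Y xref t \<in> space (prob_algebra (system_space t))"
proof (induction t)
  case 0
  have "prob_space (pg_init SX r0 N Y xref)" "sets (pg_init SX r0 N Y xref) = sets (system_space 0)"
    unfolding pg_init_def using pg_init_component
    by (auto simp: space_prob_algebra intro!: prob_space_PiM sets_PiM_cong)
  then show ?case
    by (simp add: space_prob_algebra)
next
  case (Suc t)
  then show ?case
    using prob_space_bind'[OF _ measurable_pg_step] sets_bind'[OF _ measurable_pg_step]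
    by (simp add: space_prob_algebra)
qed

subsection \<open>The backward recursion\<close>

text \<open>With \<open>f = indicator D\<close> and \<open>h = 1\<close> this is the integrand of
  the particle Gibbs kernel. Allowing a general \<open>h\<close> of the last state keeps the form
  closed under backward steps.\<close>

definition ratio :: "nat \<Rightarrow> ((nat \<Rightarrow> 'a) \<Rightarrow> ennreal) \<Rightarrow> ('a \<Rightarrow> ennreal) \<Rightarrow> (nat \<Rightarrow> nat \<Rightarrow> 'a) \<Rightarrow> ennreal" where
  "ratio t f h z = (\<Sum>i=1..N. ennreal (W t (z i)) * f (z i)) / (\<Sum>i=1..N. ennreal (W t (z i)) * h (z i t))"

text \<open>The denominator left when the last \<open>t + 1\<close> generations have been integrated
  out: \<open>h\<close> is transformed backwards at each time, and at time 0 the path integral takes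
  the place of \<open>Q_op\<close>.\<close>

primrec denom :: "nat \<Rightarrow> ('a \<Rightarrow> ennreal) \<Rightarrow> ennreal" where
  "denom 0 h = 2 * (Wnorm 0 * sup_norm SX h) + of_nat (N - 2) * path_int 0 (\<lambda>p. h (p 0))"
| "denom (Suc t) h =
     denom t (\<lambda>x. 2 * (Wnorm (Suc t) * sup_norm SX h) + of_nat (N - 2) * Q_op (Suc t) h x)"

lemma measurable_last:
  "h \<in> borel_measurable SX \<Longrightarrow> (\<lambda>p. h (p t)) \<in> borel_measurable (path_space SX t)"
  by (rule measurable_compose[OF measurable_component_singleton]) auto

lemma measurable_weight_times:
  assumes t: "t \<le> T" and [measurable]: "f \<in> borel_measurable (path_space SX t)"
  shows "(\<lambda>p. ennreal (W t p) * f p) \<in> borel_measurable (path_space SX t)"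
proof -
  note [measurable] = measurable_weight[OF t]
  show ?thesis by measurable
qed

lemma measurable_ratio:
  assumes t: "t \<le> T" and f: "f \<in> borel_measurable (path_space SX t)" and h: "h \<in> borel_measurable SX"
  shows "ratio t f h \<in> borel_measurable (system_space t)"
proof -
  have comp: "(\<lambda>z. F (z i)) \<in> borel_measurable (system_space t)"
    if "i \<in> {1..N}" "F \<in> borel_measurable (path_space SX t)" for F :: "(nat \<Rightarrow> 'a) \<Rightarrow> ennreal" and i
    by (rule measurable_compose[OF measurable_component_singleton[OF that(1)] that(2)])
  show ?thesis
    unfolding ratio_def[abs_def]
    by (intro borel_measurable_divide_ennreal borel_measurable_sum
        comp[OF _ measurable_weight_times[OF t f]] comp[OF _ measurable_weight_times[OF t measurable_last[OF h]]])
qed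

lemma ratio_step:
  assumes prob: "\<And>i. prob_space (K i)" and sets_K: "\<And>i. sets (K i) = sets (path_space SX t)"
    and K: "\<And>i. i \<noteq> N \<Longrightarrow> K i = \<nu>"
    and t: "t \<le> T" and f: "f \<in> borel_measurable (path_space SX t)" and h: "h \<in> borel_measurable SX"
  shows "of_nat (N - 1) * (\<integral>\<^sup>+ p. ennreal (W t p) * f p \<partial>\<nu>) /
      (2 * (Wnorm t * sup_norm SX h) + of_nat (N - 2) * (\<integral>\<^sup>+ p. ennreal (W t p) * h (p t) \<partial>\<nu>))
    \<le> (\<integral>\<^sup>+ z. ratio t f h z \<partial>PiM {1..N} K)"
proof -
  \<comment> \<open>This bound is the constant \<open>C\<close> of the general inequality for
    ratios.\<close>
  have "ennreal (W t p) * h (p t) \<le> Wnorm t * sup_norm SX h" if "p \<in> space (path_space SX t)" for p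
    using path_in_space[OF that order_refl] weight_le_norm[OF that]
    by (intro mult_mono) (auto simp: sup_norm_def intro!: SUP_upper)
  then show ?thesis
    using nn_integral_sum_ratio_ge[of "{1..N}" N K "path_space SX t" \<nu>, OF _ _ prob sets_K K
        measurable_weight_times[OF t f] measurable_weight_times[OF t measurable_last[OF h]]] N_ge_2
    by (simp add: ratio_def)
qed

text \<open>Given \<open>z\<close>, the integrals under \<open>offspring\<close> are
  \<open>?A / ?s\<close> and \<open>?B / ?s\<close>. The normaliser \<open>?s\<close> cancels in
  their ratio, and the constant term times \<open>?s\<close> is spread over the particles, giving a
  ratio at time \<open>t\<close>.\<close>

lemma pg_step_ratio_ge:
  assumes t: "Suc t \<le> T" and f: "f \<in> borel_measurable (path_space SX (Suc t))"
    and h: "h \<in> borel_measurable SX" and z: "z \<in> space (system_space t)"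
  shows "of_nat (N - 1) * ratio t (path_op t f)
      (\<lambda>x. 2 * (Wnorm (Suc t) * sup_norm SX h) + of_nat (N - 2) * Q_op (Suc t) h x) z
    \<le> (\<integral>\<^sup>+ z'. ratio (Suc t) f h z' \<partial>pg_step SX R w0 w N Y xref t z)"
proof -
  have t': "t \<le> T" using t by simp
  let ?s = "\<Sum>j=1..N. W t (z j)"
  let ?A = "\<Sum>j=1..N. ennreal (W t (z j)) * path_op t f (z j)"
  let ?B = "\<Sum>j=1..N. ennreal (W t (z j)) * Q_op (Suc t) h (z j t)"
  let ?C = "2 * (Wnorm (Suc t) * sup_norm SX h)"
  have W: "0 \<le> W t (z j)" if "j \<in> {1..N}" for j
    by (rule weight_nonneg[OF t' system_component[OF z that]])
  show ?thesis
  proof (cases "?s = 0")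
    \<comment> \<open>All weights vanish, and 0/0 is 0 in \<open>ennreal\<close>, so the left side
      is 0.\<close>
    case True
    then have "W t (z j) = 0" if "j \<in> {1..N}" for j
      using W that by (subst (asm) sum_nonneg_eq_0_iff) auto
    then show ?thesis
      by (simp add: ratio_def)
  next
    case False
    have "0 \<le> ?s"
      by (intro sum_nonneg W)
    with False have s: "ennreal ?s \<noteq> 0" "ennreal ?s \<noteq> top"
      by (auto simp: ennreal_eq_0_iff simp del: One_nat_def)
    have sE: "ennreal ?s = (\<Sum>j=1..N. ennreal (W t (z j)))"
      by (rule sum_ennreal[OF W, symmetric])
    \<comment> \<open>Brings the denominator over the common divisor \<open>s\<close>; multiplying
      and dividing by \<open>s\<close> is safe only for \<open>s\<close> nonzero and finite.\<close>
    have scale: "c + n * (b / s) = (s * c + n * b) / s" if "s \<noteq> 0" "s \<noteq> top" for c n b s :: ennreal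
      using that by (simp add: add_divide_distrib_ennreal ennreal_times_divide mult.commute[of s] mult_divide_eq_ennreal)
    have "?C + of_nat (N - 2) * (?B / ennreal ?s) = (ennreal ?s * ?C + of_nat (N - 2) * ?B) / ennreal ?s"
      by (rule scale[OF s])
    also have "ennreal ?s * ?C + of_nat (N - 2) * ?B =
        (\<Sum>j=1..N. ennreal (W t (z j)) * (?C + of_nat (N - 2) * Q_op (Suc t) h (z j t)))" (is "_ = ?D")
      unfolding sE sum_distrib_right sum_distrib_left sum.distrib[symmetric] distrib_left
      by (simp add: mult.left_commute)
    finally have D: "?C + of_nat (N - 2) * (?B / ennreal ?s) = ?D / ennreal ?s" .
    let ?K = "\<lambda>i. if i = N then return (path_space SX (Suc t)) ((z N)(Suc t := xref (Suc t))) else offspring t z"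
    have K: "prob_space (?K i)" "sets (?K i) = sets (path_space SX (Suc t))" for i
      using measurable_space[OF measurable_pg_step_component[OF t] z, of i]
      unfolding space_prob_algebra by blast+
    have A: "(\<integral>\<^sup>+ p. ennreal (W (Suc t) p) * f p \<partial>offspring t z) = ?A / ennreal ?s"
      by (rule nn_integral_offspring[OF t z f False])
    have B: "(\<integral>\<^sup>+ p. ennreal (W (Suc t) p) * h (p (Suc t)) \<partial>offspring t z) = ?B / ennreal ?s"
      using nn_integral_offspring[OF t z measurable_last[OF h] False] by (simp only: path_op_last)
    have "of_nat (N - 1) * (?A / ?D) = of_nat (N - 1) * (?A / ennreal ?s) / (?D / ennreal ?s)"
    proof -
      have "?A / ennreal ?s / (?D / ennreal ?s) = ?A / ?D"
        unfolding divide_ennreal_def[of ?A "ennreal ?s"] divide_ennreal_def[of ?D "ennreal ?s"]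
        using s by (intro divide_mult_eq) (simp_all only: ennreal_inverse_eq_0_iff ennreal_inverse_eq_top_iff
            infinity_ennreal_def not_False_eq_True)
      from this[symmetric] show ?thesis
        unfolding divide_ennreal_def by (simp only: mult.assoc)
    qed
    also have "\<dots> \<le> (\<integral>\<^sup>+ z'. ratio (Suc t) f h z' \<partial>PiM {1..N} ?K)"
      using ratio_step[where \<nu>="offspring t z", OF K _ t f h] unfolding A B D by simp
    finally show ?thesis
      unfolding pg_step_eq by (simp only: ratio_def)
  qed
qed

text \<open>Generations are integrated out from the last to the first, each contributing a factor
  \<open>N - 1\<close>; there are \<open>Suc t\<close> of them, counting time 0. Both
  \<open>f\<close> and \<open>h\<close> change on the way and are therefore generalised in the
  induction.\<close>

lemma pg_law_ratio_ge:
  "t \<le> T \<Longrightarrow> f \<in> borel_measurable (path_space SX t) \<Longrightarrow> h \<in> borel_measurable SX \<Longrightarrow>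
    of_nat (N - 1) ^ Suc t * path_int t f / denom t h \<le> (\<integral>\<^sup>+ z. ratio t f h z \<partial>pg_law SX r0 R w0 w N Y xref t)"
proof (induction t arbitrary: f h)
  case 0
  let ?K = "\<lambda>i. if i = N then return (path_space SX 0) (init_path (xref 0))
    else distr (r0 (Y 0)) (path_space SX 0) init_path"
  let ?\<nu> = "distr (r0 (Y 0)) (path_space SX 0) init_path"
  have K: "prob_space (?K i)" "sets (?K i) = sets (path_space SX 0)" for i
    using pg_init_component[of i] unfolding space_prob_algebra by blast+
  have int: "(\<integral>\<^sup>+ p. ennreal (W 0 p) * f p \<partial>?\<nu>) = path_int 0 f"
    if f: "f \<in> borel_measurable (path_space SX 0)" for f
  proof -
    have "sets (r0 (Y 0)) = sets SX"
      using r0_prob[OF Y_space[of 0]] by (simp add: space_prob_algebra)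
    then have "(\<integral>\<^sup>+ p. ennreal (W 0 p) * f p \<partial>?\<nu>) =
        (\<integral>\<^sup>+ x. ennreal (W 0 (init_path x)) * f (init_path x) \<partial>r0 (Y 0))"
      using measurable_init_path measurable_weight_times[OF _ f]
      by (intro nn_integral_distr) (simp_all cong: measurable_cong_sets del: atMost_0)
    also have "\<dots> = path_int 0 f"
      using nn_integral_r0_weight[OF measurable_compose[OF measurable_init_path f]]
      by (simp add: weight_0 init_path_def)
    finally show ?thesis .
  qed
  have "of_nat (N - 1) * path_int 0 f / denom 0 h \<le> (\<integral>\<^sup>+ z. ratio 0 f h z \<partial>PiM {1..N} ?K)"
    using ratio_step[where \<nu>="?\<nu>", OF K _ 0] unfolding int[OF 0(2)] int[OF measurable_last[OF 0(3)]] denom.simps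
    by simp
  then show ?case
    by (simp add: pg_init_def)
next
  case (Suc t)
  let ?h = "\<lambda>x. 2 * (Wnorm (Suc t) * sup_norm SX h) + of_nat (N - 2) * Q_op (Suc t) h x"
  let ?P = "pg_law SX r0 R w0 w N Y xref t"
  have t: "t \<le> T" using Suc.prems by simp
  have P: "sets ?P = sets (system_space t)"
    using pg_law_space[OF t] by (simp add: space_prob_algebra)
  note space_P = sets_eq_imp_space_eq[OF P]
  have [measurable]: "Q_op (Suc t) h \<in> borel_measurable SX"
    by (rule measurable_Q_op[OF Suc.prems(1,3)])
  have h: "?h \<in> borel_measurable SX"
    by measurable
  have f: "path_op t f \<in> borel_measurable (path_space SX t)"
    by (rule measurable_path_op[OF Suc.prems(1,2)])
  have "of_nat (N - 1) ^ Suc (Suc t) * path_int (Suc t) f / denom (Suc t) h =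
      of_nat (N - 1) * (of_nat (N - 1) ^ Suc t * path_int t (path_op t f) / denom t ?h)"
    by (simp only: path_int_Suc denom.simps ennreal_times_divide power_Suc mult.assoc)
  also have "\<dots> \<le> of_nat (N - 1) * (\<integral>\<^sup>+ z. ratio t (path_op t f) ?h z \<partial>?P)"
    by (intro mult_left_mono Suc.IH t f h) simp
  also have "\<dots> = (\<integral>\<^sup>+ z. of_nat (N - 1) * ratio t (path_op t f) ?h z \<partial>?P)"
    using measurable_ratio[OF t f h]
    by (intro nn_integral_cmult[symmetric]) (simp add: measurable_cong_sets[OF P refl])
  \<comment> \<open>Conditioning on the generation at time \<open>t\<close>, the one-step bound
    applies pointwise.\<close>
  also have "\<dots> \<le> (\<integral>\<^sup>+ z. \<integral>\<^sup>+ z'. ratio (Suc t) f h z' \<partial>pg_step SX R w0 w N Y xref t z \<partial>?P)"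
    using Suc.prems by (intro nn_integral_mono pg_step_ratio_ge) (auto simp: space_P)
  also have "\<dots> = (\<integral>\<^sup>+ z. ratio (Suc t) f h z \<partial>pg_law SX r0 R w0 w N Y xref (Suc t))"
    unfolding pg_law.simps
    by (rule nn_integral_bind[symmetric, OF measurable_ratio[OF Suc.prems]])
      (simp only: measurable_cong_sets[OF P refl] measurable_prob_algebraD[OF measurable_pg_step[OF Suc.prems(1)]])
  finally show ?case .
qed

section \<open>Comparison of the recursion with the constants B\<close>

lemma weight_norm_mass_le:
  assumes t: "t + l \<le> T"
  shows "Wnorm t * sup_norm SX (mass l t) * (if t = 0 then 1 else likelihood \<mu> M g Y (t - 1))
    \<le> B_const SX \<mu> M g w0 w Y t T * likelihood \<mu> M g Y (t + l)"
proof -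
  \<comment> \<open>The likelihood up to \<open>t - 1\<close>, read as 1 for the empty record; this
    unifies the two cases of \<open>cond_likelihood\<close>.\<close>
  let ?P = "if t = 0 then 1 else likelihood \<mu> M g Y (t - 1)"
  have t': "t - 1 \<le> T"
    using t by simp
  have P: "?P \<noteq> 0" "?P \<noteq> top"
    using likelihood_pos[OF t'] likelihood_finite[OF t'] by auto
  have L: "likelihood \<mu> M g Y (t + l) \<noteq> 0" "likelihood \<mu> M g Y (t + l) \<noteq> top"
    using likelihood_pos[OF t] likelihood_finite[OF t] by auto
  have c: "cond_likelihood \<mu> M g Y t (t + l) = likelihood \<mu> M g Y (t + l) / ?P"
    using P(1) by (auto simp: cond_likelihood_def divide_ennreal_def)
  have "sup_norm SX (kernel_apply (Q_comp SX M g Y (t + 1) (t + l)) (\<lambda>_. 1)) = sup_norm SX (mass l t)"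
    unfolding sup_norm_def using kernel_apply_Q_comp[OF t] by (intro SUP_cong) auto
  then have "Wnorm t * sup_norm SX (mass l t) / (likelihood \<mu> M g Y (t + l) / ?P) \<le> B_const SX \<mu> M g w0 w Y t T"
    unfolding B_const_def c[symmetric] using t by (intro SUP_upper2[of l]) auto
  \<comment> \<open>Multiplying out the definition of B leaves an inequality without division, which
    can be summed over \<open>l\<close>.\<close>
  then have "Wnorm t * sup_norm SX (mass l t) / (likelihood \<mu> M g Y (t + l) / ?P) * likelihood \<mu> M g Y (t + l)
      \<le> B_const SX \<mu> M g w0 w Y t T * likelihood \<mu> M g Y (t + l)"
    by (rule mult_right_mono) simp
  also have "Wnorm t * sup_norm SX (mass l t) / (likelihood \<mu> M g Y (t + l) / ?P) * likelihood \<mu> M g Y (t + l)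
      = Wnorm t * sup_norm SX (mass l t) * ?P"
  proof -
    have cancel: "inverse (q / p) * q = p" if pq: "p \<noteq> 0" "p \<noteq> top" "q \<noteq> 0" "q \<noteq> top" for p q :: ennreal
    proof -
      obtain p' q' where "p = ennreal p'" "0 < p'" "q = ennreal q'" "0 < q'"
        using pq by (cases p; cases q) (auto simp: less_le)
      then show ?thesis
        by (simp add: divide_ennreal inverse_ennreal ennreal_mult[symmetric])
    qed
    show ?thesis
      unfolding divide_ennreal_def[of _ "_ / _"] mult.assoc cancel[OF P L] ..
  qed
  finally show ?thesis .
qed

text \<open>The functions \<open>h\<close> produced by the recursion for \<open>denom\<close> from \<open>1\<close> at time \<open>T\<close> are nonnegative
  combinations of the \<open>mass l t\<close>; for these the supremum is comparable to the filter mean.\<close>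

lemma weight_norm_combination_le:
  assumes t: "t \<le> T" and h: "\<And>x. x \<in> space SX \<Longrightarrow> h x = (\<Sum>l\<le>T - t. c l * mass l t x)"
  shows "Wnorm t * sup_norm SX h * (if t = 0 then 1 else likelihood \<mu> M g Y (t - 1))
    \<le> B_const SX \<mu> M g w0 w Y t T * path_int t (\<lambda>p. h (p t))"
proof -
  let ?P = "if t = 0 then 1 else likelihood \<mu> M g Y (t - 1)"
  have tl: "t + l \<le> T" if "l \<in> {..T - t}" for l
    using t that by auto
  \<comment> \<open>The supremum is subadditive on nonnegative combinations.\<close>
  have "sup_norm SX h \<le> (\<Sum>l\<le>T - t. c l * sup_norm SX (mass l t))"
    unfolding sup_norm_def
    by (intro SUP_least) (auto simp: h intro!: sum_mono mult_left_mono SUP_upper)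
  then have "Wnorm t * sup_norm SX h * ?P \<le> Wnorm t * (\<Sum>l\<le>T - t. c l * sup_norm SX (mass l t)) * ?P"
    by (intro mult_right_mono mult_left_mono) auto
  also have "\<dots> = (\<Sum>l\<le>T - t. c l * (Wnorm t * sup_norm SX (mass l t) * ?P))"
    unfolding sum_distrib_left sum_distrib_right by (intro sum.cong refl) (simp only: mult_ac)
  \<comment> \<open>Each likelihood is also the path integral of \<open>mass l t\<close>, so the
    bound recombines into the integral of \<open>h\<close>.\<close>
  also have "\<dots> \<le> (\<Sum>l\<le>T - t. c l * (B_const SX \<mu> M g w0 w Y t T * path_int t (\<lambda>p. mass l t (p t))))"
    unfolding path_int_mass using tl by (intro sum_mono mult_left_mono weight_norm_mass_le) auto
  also have "\<dots> = B_const SX \<mu> M g w0 w Y t T * (\<Sum>l\<le>T - t. c l * path_int t (\<lambda>p. mass l t (p t)))"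
    unfolding sum_distrib_left by (intro sum.cong refl) (simp only: mult_ac)
  also have "(\<Sum>l\<le>T - t. c l * path_int t (\<lambda>p. mass l t (p t))) = path_int t (\<lambda>p. \<Sum>l\<le>T - t. c l * mass l t (p t))"
    using tl by (intro path_int_sum[symmetric] t measurable_last measurable_mass) auto
  also have "\<dots> = path_int t (\<lambda>p. h (p t))"
    by (intro path_int_cong) (simp add: h path_in_space)
  finally show ?thesis .
qed

abbreviation eps_denom :: "nat \<Rightarrow> ennreal" where
  "eps_denom t \<equiv> 2 * B_const SX \<mu> M g w0 w Y t T + of_nat (N - 2)"

text \<open>A backward step sends \<open>mass l (Suc t)\<close> to \<open>mass (Suc l) t\<close> and
  adds a multiple of \<open>mass 0 t = 1\<close>, so combinations stay combinations. The comparison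
  for these turns each step into a factor \<open>eps_denom\<close>.\<close>

lemma denom_le:
  "t \<le> T \<Longrightarrow> h \<in> borel_measurable SX \<Longrightarrow>
    (\<And>x. x \<in> space SX \<Longrightarrow> h x = (\<Sum>l\<le>T - t. c l * mass l t x)) \<Longrightarrow>
    denom t h \<le> (\<Prod>s\<le>t. eps_denom s) * path_int t (\<lambda>p. h (p t))"
proof (induction t arbitrary: h c)
  case 0
  have "2 * (Wnorm 0 * sup_norm SX h) \<le> 2 * (B_const SX \<mu> M g w0 w Y 0 T * path_int 0 (\<lambda>p. h (p 0)))"
    using weight_norm_combination_le[OF 0(1,3)] by (intro mult_left_mono) auto
  then have "denom 0 h \<le> 2 * (B_const SX \<mu> M g w0 w Y 0 T * path_int 0 (\<lambda>p. h (p 0)))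
      + of_nat (N - 2) * path_int 0 (\<lambda>p. h (p 0))"
    unfolding denom.simps by (intro add_mono order_refl)
  also have "\<dots> = (\<Prod>s\<le>0. eps_denom s) * path_int 0 (\<lambda>p. h (p 0))"
    by (simp only: atMost_0 prod.insert prod.empty finite.emptyI empty_iff not_False_eq_True mult_1_right
        distrib_right mult.assoc)
  finally show ?case .
next
  case (Suc t)
  let ?C = "Wnorm (Suc t) * sup_norm SX h"
  let ?h = "\<lambda>x. 2 * ?C + of_nat (N - 2) * Q_op (Suc t) h x"
  have t: "t \<le> T" using Suc.prems by simp
  have [measurable]: "Q_op (Suc t) h \<in> borel_measurable SX"
    by (rule measurable_Q_op[OF Suc.prems(1,2)])
  \<comment> \<open>The new constant is the coefficient of \<open>mass 0 t\<close>; the old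
    coefficients move up one index and are multiplied by \<open>N - 2\<close>.\<close>
  have comb: "?h x = (\<Sum>l\<le>T - t. (case l of 0 \<Rightarrow> 2 * ?C | Suc l \<Rightarrow> of_nat (N - 2) * c l) * mass l t x)"
    if x: "x \<in> space SX" for x
  proof -
    have "Q_op (Suc t) h x = (\<integral>\<^sup>+ x'. (\<Sum>l\<le>T - Suc t. c l * (ennreal (g x' (Y (Suc t))) * mass l (Suc t) x')) \<partial>M x)"
      unfolding Q_op_def using x
      by (intro nn_integral_cong) (simp add: M_space Suc.prems(3) sum_distrib_left mult.left_commute)
    also have "\<dots> = (\<Sum>l\<le>T - Suc t. \<integral>\<^sup>+ x'. c l * (ennreal (g x' (Y (Suc t))) * mass l (Suc t) x') \<partial>M x)"
    proof (rule nn_integral_sum)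
      fix l assume l: "l \<in> {..T - Suc t}"
      note [measurable] = measurable_g[OF Suc.prems(1)]
      have [measurable]: "mass l (Suc t) \<in> borel_measurable SX"
        using l Suc.prems(1) by (intro measurable_mass) auto
      show "(\<lambda>x'. c l * (ennreal (g x' (Y (Suc t))) * mass l (Suc t) x')) \<in> borel_measurable (M x)"
        unfolding measurable_cong_sets[OF M_space(2)[OF x] refl] by measurable
    qed
    also have "\<dots> = (\<Sum>l\<le>T - Suc t. c l * mass (Suc l) t x)"
    proof (rule sum.cong[OF refl])
      fix l assume l: "l \<in> {..T - Suc t}"
      note [measurable] = measurable_g[OF Suc.prems(1)]
      have [measurable]: "mass l (Suc t) \<in> borel_measurable SX"
        using l Suc.prems(1) by (intro measurable_mass) auto
      have "(\<lambda>x'. ennreal (g x' (Y (Suc t))) * mass l (Suc t) x') \<in> borel_measurable (M x)"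
        unfolding measurable_cong_sets[OF M_space(2)[OF x] refl] by measurable
      then show "(\<integral>\<^sup>+ x'. c l * (ennreal (g x' (Y (Suc t))) * mass l (Suc t) x') \<partial>M x) = c l * mass (Suc l) t x"
        by (simp add: nn_integral_cmult Q_op_def)
    qed
    finally have "?h x = 2 * ?C + (\<Sum>l\<le>T - Suc t. of_nat (N - 2) * c l * mass (Suc l) t x)"
      by (simp add: sum_distrib_left mult.assoc)
    also have "\<dots> = (\<Sum>l\<le>Suc (T - Suc t). (case l of 0 \<Rightarrow> 2 * ?C | Suc l \<Rightarrow> of_nat (N - 2) * c l) * mass l t x)"
      by (subst sum.atMost_Suc_shift) simp
    also have "Suc (T - Suc t) = T - t"
      using Suc.prems(1) by simp
    finally show ?thesis .
  qed
  have "denom (Suc t) h = denom t ?h"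
    by simp
  also have "\<dots> \<le> (\<Prod>s\<le>t. eps_denom s) * path_int t (\<lambda>p. ?h (p t))"
    by (rule Suc.IH[OF t _ comb]) measurable
  also have "path_int t (\<lambda>p. ?h (p t)) =
      2 * ?C * likelihood \<mu> M g Y t + of_nat (N - 2) * path_int (Suc t) (\<lambda>p. h (p (Suc t)))"
    unfolding path_int_Suc_last likelihood_def
    using path_int_add[OF t, of "\<lambda>_. 1" "\<lambda>p. Q_op (Suc t) h (p t)" "2 * ?C" "of_nat (N - 2)"]
    by (simp add: measurable_last)
  \<comment> \<open>The constant \<open>2 * ?C\<close> integrates to itself times the likelihood up
    to \<open>t\<close>, exactly the factor in the comparison at time \<open>Suc t\<close>.\<close>
  also have "(\<Prod>s\<le>t. eps_denom s) * \<dots> \<le>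
      (\<Prod>s\<le>t. eps_denom s) * (eps_denom (Suc t) * path_int (Suc t) (\<lambda>p. h (p (Suc t))))"
    using mult_left_mono[OF weight_norm_combination_le[OF Suc.prems(1,3)], of 2]
    by (intro mult_left_mono) (simp_all add: distrib_right mult.assoc del: path_integral.simps)
  also have "\<dots> = (\<Prod>s\<le>Suc t. eps_denom s) * path_int (Suc t) (\<lambda>p. h (p (Suc t)))"
    by (simp only: prod.atMost_Suc mult_ac)
  finally show ?case .
qed

section \<open>The minorisation of the particle Gibbs kernel\<close>

lemma particle_gibbs_eq:
  "particle_gibbs SX r0 R w0 w N Y T xref D =
    (\<integral>\<^sup>+ z. ratio T (indicator D) (\<lambda>_. 1) z \<partial>pg_law SX r0 R w0 w N Y xref T)"
  unfolding particle_gibbs_def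
proof (rule nn_integral_cong)
  fix z assume "z \<in> space (pg_law SX r0 R w0 w N Y xref T)"
  then have z: "z \<in> space (system_space T)"
    using pg_law_space[OF order_refl] by (auto simp: space_prob_algebra dest: sets_eq_imp_space_eq)
  let ?s = "\<Sum>i=1..N. W T (z i)" and ?a = "\<Sum>i=1..N. W T (z i) * indicator D (z i)"
  have W: "0 \<le> W T (z j)" if "j \<in> {1..N}" for j
    by (rule weight_nonneg[OF order_refl system_component[OF z that]])
  have ind: "ennreal (indicator D x) = indicator D x" for x
    by (simp add: indicator_def)
  have "(\<Sum>i=1..N. ennreal (W T (z i)) * indicator D (z i)) = (\<Sum>i=1..N. ennreal (W T (z i) * indicator D (z i)))"
    using W by (intro sum.cong refl) (auto simp: ennreal_mult ind)
  also have "\<dots> = ennreal ?a"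
    by (intro sum_ennreal mult_nonneg_nonneg W) auto
  finally have a: "(\<Sum>i=1..N. ennreal (W T (z i)) * indicator D (z i)) = ennreal ?a" .
  have s: "(\<Sum>i=1..N. ennreal (W T (z i)) * 1) = ennreal ?s"
    unfolding mult_1_right by (intro sum_ennreal W)
  show "ennreal (?a / ?s) = ratio T (indicator D) (\<lambda>_. 1) z"
  proof (cases "?s = 0")
    \<comment> \<open>Real division by 0 and 0/0 in \<open>ennreal\<close> both give 0, so the two
      forms agree.\<close>
    case True
    then have "W T (z j) = 0" if "j \<in> {1..N}" for j
      using W that by (subst (asm) sum_nonneg_eq_0_iff) auto
    then show ?thesis
      by (simp add: ratio_def)
  next
    case False
    have "0 \<le> ?s" "0 \<le> ?a"
      using W by (auto intro!: sum_nonneg mult_nonneg_nonneg)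
    with False show ?thesis
      unfolding ratio_def a s by (intro divide_ennreal[symmetric]) auto
  qed
qed

text \<open>The bound for ratios at time \<open>T\<close> with \<open>f = indicator D\<close> and
  \<open>h = 1\<close>, combined with \<open>denom_le\<close>: the denominator is at most the
  product of the \<open>eps_denom\<close> times the likelihood.\<close>

lemma particle_gibbs_ge:
  assumes D: "D \<in> sets (path_space SX T)"
  shows "epsilon_const SX \<mu> M g w0 w Y T N * joint_smoothing \<mu> M g Y T D
    \<le> particle_gibbs SX r0 R w0 w N Y T xref D"
proof (cases "\<exists>t\<le>T. eps_denom t = top")
  \<comment> \<open>An infinite factor in the denominator makes epsilon 0.\<close>
  case True
  then obtain t where "t \<le> T" "eps_denom t = top"
    by blast
  then have "epsilon_const SX \<mu> M g w0 w Y T N = 0"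
    unfolding epsilon_const_def by (intro prod_zero bexI[of _ t]) (simp_all del: ennreal_add_eq_top)
  then show ?thesis
    by simp
next
  case False
  define L where "L = likelihood \<mu> M g Y T"
  define P where "P = (\<Prod>t\<le>T. eps_denom t)"
  \<comment> \<open>Inverses multiply as long as no product of 0 and infinity occurs, so finiteness
    of the product is carried through the induction.\<close>
  have "inverse (\<Prod>t\<in>S. eps_denom t) = (\<Prod>t\<in>S. inverse (eps_denom t)) \<and> (\<Prod>t\<in>S. eps_denom t) < top"
    if "finite S" "S \<subseteq> {..T}" for S
    using that
  proof (induction S)
    case (insert t S)
    then show ?case
      using False by (auto simp: ennreal_inverse_mult ennreal_mult_less_top less_top simp del: ennreal_add_eq_top)
  qed simp
  from this[of "{..T}"] have P: "inverse P = (\<Prod>t\<le>T. inverse (eps_denom t))" "P < top"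
    by (auto simp: P_def)
  have L: "L < top"
    using likelihood_finite[OF order_refl] by (simp add: L_def)
  \<comment> \<open>At \<open>t = T\<close> the combination has the single index
    \<open>l = 0\<close>, and the constant 1 is \<open>mass 0 T\<close> with coefficient 1.\<close>
  have "denom T (\<lambda>_. 1) \<le> P * path_int T (\<lambda>p. 1)"
    unfolding P_def using denom_le[of T "\<lambda>_. 1" "\<lambda>_. 1"] by simp
  then have le: "denom T (\<lambda>_. 1) \<le> P * L"
    by (simp add: L_def likelihood_def)
  have "epsilon_const SX \<mu> M g w0 w Y T N = of_nat (N - 1) ^ Suc T * inverse P"
    unfolding epsilon_const_def P by (simp add: divide_ennreal_def prod.distrib atLeast0AtMost)
  then have "epsilon_const SX \<mu> M g w0 w Y T N * joint_smoothing \<mu> M g Y T D =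
      of_nat (N - 1) ^ Suc T * path_int T (indicator D) / (P * L)"
    using P L by (simp add: joint_smoothing_def L_def[symmetric] divide_ennreal_def ennreal_inverse_mult mult_ac)
  also have "\<dots> \<le> of_nat (N - 1) ^ Suc T * path_int T (indicator D) / denom T (\<lambda>_. 1)"
    unfolding divide_ennreal_def by (intro mult_left_mono inverse_ennreal_antimono le) simp
  also have "\<dots> \<le> particle_gibbs SX r0 R w0 w N Y T xref D"
    unfolding particle_gibbs_eq using D by (intro pg_law_ratio_ge) auto
  finally show ?thesis .
qed

end

theorem theorem1:
  fixes SX :: "'a measure" and SY :: "'b measure"
    and M :: "'a \<Rightarrow> 'a measure" and g :: "'a \<Rightarrow> 'b \<Rightarrow> real"
    and G :: "'a \<Rightarrow> 'b measure" and \<kappa> :: "'b measure" and \<mu> :: "'a measure"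
    and Y :: "nat \<Rightarrow> 'b"
    and r0 :: "'b \<Rightarrow> 'a measure" and R :: "'b \<Rightarrow> 'a \<Rightarrow> 'a measure"
    and w0 :: "'b \<Rightarrow> 'a \<Rightarrow> real" and w :: "'b \<Rightarrow> 'a \<Rightarrow> 'a \<Rightarrow> real"
    and N T :: nat and xref :: "nat \<Rightarrow> 'a" and D :: "(nat \<Rightarrow> 'a) set"
  assumes M_kernel: "M \<in> SX \<rightarrow>\<^sub>M prob_algebra SX"
    and g_measurable: "(\<lambda>(x, y). g x y) \<in> borel_measurable (SX \<Otimes>\<^sub>M SY)"
    and g_nonneg: "\<And>x y. x \<in> space SX \<Longrightarrow> y \<in> space SY \<Longrightarrow> 0 \<le> g x y"
    and G_kernel: "G \<in> SX \<rightarrow>\<^sub>M prob_algebra SY"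
    and kappa_sets: "sets \<kappa> = sets SY"
    and G_density: "\<And>x. x \<in> space SX \<Longrightarrow> G x = density \<kappa> (\<lambda>y. ennreal (g x y))"
    and mu_prob: "\<mu> \<in> space (prob_algebra SX)"
    and Y_space: "\<And>t. t \<le> T \<Longrightarrow> Y t \<in> space SY"
    and likelihood_pos: "\<And>t. t \<le> T \<Longrightarrow> 0 < likelihood \<mu> M g Y t"
    and likelihood_finite: "\<And>t. t \<le> T \<Longrightarrow> likelihood \<mu> M g Y t < \<infinity>"
    and r0_prob: "\<And>y. y \<in> space SY \<Longrightarrow> r0 y \<in> space (prob_algebra SX)"
    and r0_ac: "\<And>y. y \<in> space SY \<Longrightarrow> absolutely_continuous (r0 y) \<mu>"
    and R_kernel: "\<And>y. y \<in> space SY \<Longrightarrow> R y \<in> SX \<rightarrow>\<^sub>M prob_algebra SX"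
    and R_ac: "\<And>y x. y \<in> space SY \<Longrightarrow> x \<in> space SX \<Longrightarrow>
                 absolutely_continuous (R y x) (Q_kernel M g y x)"
    and w0_measurable: "\<And>y. y \<in> space SY \<Longrightarrow> w0 y \<in> borel_measurable SX"
    and w0_nonneg: "\<And>y x. y \<in> space SY \<Longrightarrow> x \<in> space SX \<Longrightarrow> 0 \<le> w0 y x"
    and w0_version: "\<And>y. y \<in> space SY \<Longrightarrow>
                       AE x in r0 y. ennreal (w0 y x) = ennreal (g x y) * RN_deriv (r0 y) \<mu> x"
    and w_measurable: "\<And>y. y \<in> space SY \<Longrightarrow>
                         (\<lambda>(x, x'). w y x x') \<in> borel_measurable (SX \<Otimes>\<^sub>M SX)"
    and w_nonneg: "\<And>y x x'. y \<in> space SY \<Longrightarrow> x \<in> space SX \<Longrightarrow> x' \<in> space SX \<Longrightarrow> 0 \<le> w y x x'"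
    and w_version: "\<And>y x. y \<in> space SY \<Longrightarrow> x \<in> space SX \<Longrightarrow>
                      AE x' in R y x. ennreal (w y x x') = RN_deriv (R y x) (Q_kernel M g y x) x'"
    and N_ge_2: "2 \<le> N"
    and xref: "xref \<in> space (path_space SX T)"
    and D: "D \<in> sets (path_space SX T)"
    and weights_pos: "\<And>t. t \<le> T \<Longrightarrow>
                        AE z in pg_law SX r0 R w0 w N Y xref t. 0 < (\<Sum>i=1..N. weight w0 w Y t (z i))"
  shows "particle_gibbs SX r0 R w0 w N Y T xref D \<ge>
           epsilon_const SX \<mu> M g w0 w Y T N * joint_smoothing \<mu> M g Y T D"
proof -
  interpret particle_gibbs_model SX SY M g \<mu> Y r0 R w0 w N T xref
    using assms by unfold_locales
  show ?thesis
    using D by (rule particle_gibbs_ge)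
qed

end
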